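(* Let $\mathbb{A}$ be a double category which has conjoints and is right closed. Then the internal right hom, given on objects by $(x,z)\mapsto z/x$ (with its action on morphisms described in the context), is a functor $/\colon \mathbf{TS}(\mathbb{A})\to\mathbf{A}_1$.
   Context: Double categories. A double category $\mathbb{A}$ has objects, horizontal arrows (composed strictly: composite $gf$, identity $1_A$), vertical arrows $v\colon A\nrightarrow C$ (composite $w\bullet v$ meaning $v$ first, identity $\mathrm{id}_A$; vertical composition is associative up to coherent isomorphism, vertical identities are taken strict) and cells. A cell has a top $f\colon A\to B$, a bottom $g\colon C\to D$ (horizontal arrows), a left side $v\colon A\nrightarrow C$ and a right side $w\colon B\nrightarrow D$ (vertical arrows). $\alpha\mid\beta$ denotes horizontal pasting ($\alpha$ left of $\beta$) and $\frac{\alpha}{\beta}$ vertical pasting ($\alpha$ above $\beta$); $1_v$ is the horizontal identity cell on $v$. A globular cell $v\Rightarrow w$ has left $v$, right $w$ and identity top and bottom. Associativity isomorphisms are suppressed. Conjoints. A conjoint of $f\colon A\to B$ is a vertical arrow $f^*\colon B\nrightarrow A$ with cells $\alpha_f$ (top $f$, left $\mathrm{id}_A$, right $f^*$, bottom $1_A$) and $\beta_f$ (top $1_B$, left $f^*$, right $\mathrm{id}_B$, bottom $f$) such that $\alpha_f\mid\beta_f=\mathrm{id}_f$ (vertical identity cell) and $\frac{\beta_f}{\alpha_f}=1_{f^*}$. Conjoints are chosen, with $1_A^*=\mathrm{id}_A$; there are canonical isomorphisms $(hf)^*\cong f^*\bullet h^*$. Coretrocells. A coretrocell with top $f\colon A\to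 B$, left $v\colon A\nrightarrow C$, right $w\colon B\nrightarrow D$, bottom $g\colon C\to D$ is a globular cell $g^*\bullet w\Rightarrow v\bullet f^*$. Horizontal composite of $\alpha\colon g^*\bullet w\Rightarrow v\bullet f^*$ with $\beta\colon k^*\bullet x\Rightarrow w\bullet h^*$ (top $h$, left $w$, right $x$, bottom $k$): $(kg)^*\bullet x\cong g^*\bullet k^*\bullet x\Rightarrow g^*\bullet w\bullet h^*\Rightarrow v\bullet f^*\bullet h^*\cong v\bullet(hf)^*$. Right closed. $\mathbb{A}$ is right closed (has strong right homs) if for all $x\colon A\nrightarrow B$ and $z\colon A\nrightarrow C$ there is a vertical arrow $z/x\colon B\nrightarrow C$ and a globular cell $\epsilon'\colon (z/x)\bullet x\Rightarrow z$ such that for all $g\colon C'\to C$, $y\colon B\nrightarrow C'$ and every cell $\alpha$ with top $1_A$, left $y\bullet x$, right $z$, bottom $g$ there is a unique cell $\beta$ with top $1_B$, left $y$, right $z/x$, bottom $g$ such that $\frac{1_x}{\beta}\,\big|\,\epsilon'=\alpha$. Categories. $\mathbf{A}_1$ is the category whose objects are vertical arrows of $\mathbb{A}$ and whose morphisms $v\to w$ are cells with left $v$ and right $w$, composed horizontally. $\mathbf{TS}(\mathbb{A})$ has as objects spans $(x,z)$ of vertical arrows $x\colon A\nrightarrow B$, $z\colon A\nrightarrow C$; a morphism $(x,z)\to(x',z')$, with $x'\colon A'\nrightarrow B'$, $z'\colon A'\nrightarrow C'$, consists of horizontal arrows $a\colon A\to A'$, $b\colon B\to B'$, $c\colon C\to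 C'$, a coretrocell $\alpha$ with top $a$, left $x$, right $x'$, bottom $b$ (i.e. $\alpha\colon b^*\bullet x'\Rightarrow x\bullet a^*$) and a cell $\gamma$ with top $a$, left $z$, right $z'$, bottom $c$; composition is componentwise horizontal composition. Action on morphisms. $(\alpha,\gamma)$ is sent to the unique cell $\xi$ with top $b$, left $z/x$, right $z'/x'$, bottom $c$ such that the vertical pasting of $1_{x'}$, $\beta_b$, $\xi$ (top to bottom), followed horizontally on the right by the evaluation cell $(z'/x')\bullet x'\Rightarrow z'$, equals the horizontal pasting (left to right) of $1_{z/x}\bullet\alpha\colon (z/x)\bullet b^*\bullet x'\Rightarrow (z/x)\bullet x\bullet a^*$, $\epsilon'\bullet 1_{a^*}\colon (z/x)\bullet x\bullet a^*\Rightarrow z\bullet a^*$, and $\frac{\beta_a}{\gamma}$. *)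

theory Defs
  imports Main
begin

record ('o, 'a) cat_data =
  Ob :: "'o set"
  Ar :: "'a set"
  Dom :: "'a \<Rightarrow> 'o"
  Cod :: "'a \<Rightarrow> 'o"
  Id :: "'o \<Rightarrow> 'a"
  Comp :: "'a \<Rightarrow> 'a \<Rightarrow> 'a"  (* Comp C g f is "g after f" *)

locale category =
  fixes C :: "('o, 'a) cat_data"
  assumes Dom_in: "f \<in> Ar C \<Longrightarrow> Dom C f \<in> Ob C"
    and Cod_in: "f \<in> Ar C \<Longrightarrow> Cod C f \<in> Ob C"
    and Id_in: "x \<in> Ob C \<Longrightarrow> Id C x \<in> Ar C"
    and Dom_Id: "x \<in> Ob C \<Longrightarrow> Dom C (Id C x) = x"
    and Cod_Id: "x \<in> Ob C \<Longrightarrow> Cod C (Id C x) = x"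
    and Comp_in: "\<lbrakk>f \<in> Ar C; g \<in> Ar C; Cod C f = Dom C g\<rbrakk> \<Longrightarrow> Comp C g f \<in> Ar C"
    and Dom_Comp: "\<lbrakk>f \<in> Ar C; g \<in> Ar C; Cod C f = Dom C g\<rbrakk> \<Longrightarrow> Dom C (Comp C g f) = Dom C f"
    and Cod_Comp: "\<lbrakk>f \<in> Ar C; g \<in> Ar C; Cod C f = Dom C g\<rbrakk> \<Longrightarrow> Cod C (Comp C g f) = Cod C g"
    and Comp_Id_right: "f \<in> Ar C \<Longrightarrow> Comp C f (Id C (Dom C f)) = f"
    and Comp_Id_left: "f \<in> Ar C \<Longrightarrow> Comp C (Id C (Cod C f)) f = f"
    and Comp_assoc: "\<lbrakk>f \<in> Ar C; g \<in> Ar C; h \<in> Ar C; Cod C f = Dom C g; Cod C g = Dom C h\<rbrakk>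
      \<Longrightarrow> Comp C h (Comp C g f) = Comp C (Comp C h g) f"

locale is_functor = source: category C + target: category D
  for C :: "('o, 'a) cat_data" and D :: "('p, 'b) cat_data" +
  fixes Fo :: "'o \<Rightarrow> 'p" and Fa :: "'a \<Rightarrow> 'b"
  assumes map_Ob: "x \<in> Ob C \<Longrightarrow> Fo x \<in> Ob D"
    and map_Ar: "f \<in> Ar C \<Longrightarrow> Fa f \<in> Ar D"
    and map_Dom: "f \<in> Ar C \<Longrightarrow> Dom D (Fa f) = Fo (Dom C f)"
    and map_Cod: "f \<in> Ar C \<Longrightarrow> Cod D (Fa f) = Fo (Cod C f)"
    and map_Id: "x \<in> Ob C \<Longrightarrow> Fa (Id C x) = Id D (Fo x)"
    and map_Comp: "\<lbrakk>f \<in> Ar C; g \<in> Ar C; Cod C f = Dom C g\<rbrakk>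
      \<Longrightarrow> Fa (Comp C g f) = Comp D (Fa g) (Fa f)"

text \<open>
  Compositions of arrows are written in function order (\<open>g \<cdot> f\<close>, \<open>w \<bullet> v\<close>), pastings of cells in
  reading order: \<open>\<alpha> \<parallel> \<beta>\<close> has \<open>\<alpha>\<close> on the left, \<open>\<alpha> \<sslash> \<beta>\<close> has \<open>\<alpha>\<close> above.
  Hence \<open>\<alpha> \<sslash> \<beta>\<close> has left side \<open>left \<beta> \<bullet> left \<alpha>\<close>, and whiskering a globular cell \<open>\<alpha>\<close> by \<open>v\<close>,
  classically \<open>1\<^sub>v \<bullet> \<alpha>\<close> or \<open>\<alpha> \<bullet> 1\<^sub>v\<close>, is \<open>\<alpha> \<sslash> hunit v\<close> or \<open>hunit v \<sslash> \<alpha>\<close> respectively.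
\<close>

record ('o, 'h, 'v, 'c) dblcat =
  Obj :: "'o set"
  Hor :: "'h set"
  hdom :: "'h \<Rightarrow> 'o"
  hcod :: "'h \<Rightarrow> 'o"
  hone :: "'o \<Rightarrow> 'h"
  hcomp :: "'h \<Rightarrow> 'h \<Rightarrow> 'h"  (infixl "\<cdot>\<index>" 75)
  Ver :: "'v set"
  vdom :: "'v \<Rightarrow> 'o"
  vcod :: "'v \<Rightarrow> 'o"
  vid :: "'o \<Rightarrow> 'v"
  vcomp :: "'v \<Rightarrow> 'v \<Rightarrow> 'v"  (infixl "\<bullet>\<index>" 75)
  Cells :: "'c set"
  ctop :: "'c \<Rightarrow> 'h"
  cbot :: "'c \<Rightarrow> 'h"
  cleft :: "'c \<Rightarrow> 'v"
  cright :: "'c \<Rightarrow> 'v"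
  hunit :: "'v \<Rightarrow> 'c"  (* horizontal identity cell on v, written 1_v *)
  vunit :: "'h \<Rightarrow> 'c"  (* vertical identity cell on f, written id_f *)
  hpaste :: "'c \<Rightarrow> 'c \<Rightarrow> 'c"  (infixl "\<parallel>\<index>" 65)
  vpaste :: "'c \<Rightarrow> 'c \<Rightarrow> 'c"  (infixl "\<sslash>\<index>" 70)
  asc :: "'v \<Rightarrow> 'v \<Rightarrow> 'v \<Rightarrow> 'c"   (* asc w v u : (w \<bullet> v) \<bullet> u \<Rightarrow> w \<bullet> (v \<bullet> u) *)
  asc' :: "'v \<Rightarrow> 'v \<Rightarrow> 'v \<Rightarrow> 'c"  (* its inverse *)

definition A0 :: "('o, 'h, 'v, 'c) dblcat \<Rightarrow> ('o, 'h) cat_data" where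
  "A0 A = \<lparr>Ob = Obj A, Ar = Hor A, Dom = hdom A, Cod = hcod A, Id = hone A, Comp = hcomp A\<rparr>"

definition A1 :: "('o, 'h, 'v, 'c) dblcat \<Rightarrow> ('v, 'c) cat_data" where
  "A1 A = \<lparr>Ob = Ver A, Ar = Cells A, Dom = cleft A, Cod = cright A, Id = hunit A,
     Comp = (\<lambda>\<beta> \<alpha>. hpaste A \<alpha> \<beta>)\<rparr>"

definition cell ::
  "('o, 'h, 'v, 'c) dblcat \<Rightarrow> 'h \<Rightarrow> 'v \<Rightarrow> 'v \<Rightarrow> 'h \<Rightarrow> 'c \<Rightarrow> bool" where
  "cell A f v w g \<alpha> \<longleftrightarrow>
     \<alpha> \<in> Cells A \<and> ctop A \<alpha> = f \<and> cleft A \<alpha> = v \<and> cright A \<alpha> = w \<and> cbot A \<alpha> = g"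

definition globular :: "('o, 'h, 'v, 'c) dblcat \<Rightarrow> 'v \<Rightarrow> 'v \<Rightarrow> 'c \<Rightarrow> bool" where
  "globular A v w \<alpha> \<longleftrightarrow> cell A (hone A (vdom A v)) v w (hone A (vcod A v)) \<alpha>"

text \<open>
  A double category is a pseudocategory object in categories, with strict vertical units:
  the functors for source, target and vertical identities are given first, then vertical
  composition with its associativity isomorphism. Since the unit isomorphisms are identities,
  the triangle axiom says that \<open>asc w (vid b) u\<close> is an identity.
\<close>

locale double_category =
  fixes A :: "('o, 'h, 'v, 'c) dblcat" (structure)
  assumes vsource: "is_functor (A1 A) (A0 A) (vdom A) (ctop A)"
    and vtarget: "is_functor (A1 A) (A0 A) (vcod A) (cbot A)"
    and videntity: "is_functor (A0 A) (A1 A) (vid A) (vunit A)"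
    and vdom_vid: "a \<in> Obj A \<Longrightarrow> vdom A (vid A a) = a"
    and vcod_vid: "a \<in> Obj A \<Longrightarrow> vcod A (vid A a) = a"
    and ctop_vunit: "f \<in> Hor A \<Longrightarrow> ctop A (vunit A f) = f"
    and cbot_vunit: "f \<in> Hor A \<Longrightarrow> cbot A (vunit A f) = f"
    and vcomp_in: "\<lbrakk>v \<in> Ver A; w \<in> Ver A; vcod A v = vdom A w\<rbrakk> \<Longrightarrow> w \<bullet> v \<in> Ver A"
    and vdom_vcomp: "\<lbrakk>v \<in> Ver A; w \<in> Ver A; vcod A v = vdom A w\<rbrakk> \<Longrightarrow> vdom A (w \<bullet> v) = vdom A v"
    and vcod_vcomp: "\<lbrakk>v \<in> Ver A; w \<in> Ver A; vcod A v = vdom A w\<rbrakk> \<Longrightarrow> vcod A (w \<bullet> v) = vcod A w"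
    and vpaste_cell: "\<lbrakk>cell A f v w g \<alpha>; cell A g v' w' h \<beta>\<rbrakk>
      \<Longrightarrow> cell A f (v' \<bullet> v) (w' \<bullet> w) h (\<alpha> \<sslash> \<beta>)"
    and vpaste_hunit: "\<lbrakk>v \<in> Ver A; w \<in> Ver A; vcod A v = vdom A w\<rbrakk>
      \<Longrightarrow> hunit A v \<sslash> hunit A w = hunit A (w \<bullet> v)"
    and interchange: "\<lbrakk>\<alpha> \<in> Cells A; \<beta> \<in> Cells A; \<gamma> \<in> Cells A; \<delta> \<in> Cells A;
        cright A \<alpha> = cleft A \<beta>; cright A \<gamma> = cleft A \<delta>; cbot A \<alpha> = ctop A \<gamma>; cbot A \<beta> = ctop A \<delta>\<rbrakk>
      \<Longrightarrow> (\<alpha> \<parallel> \<beta>) \<sslash> (\<gamma> \<parallel> \<delta>) = (\<alpha> \<sslash> \<gamma>) \<parallel> (\<beta> \<sslash> \<delta>)"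
    and vcomp_vid_right: "v \<in> Ver A \<Longrightarrow> v \<bullet> vid A (vdom A v) = v"
    and vcomp_vid_left: "v \<in> Ver A \<Longrightarrow> vid A (vcod A v) \<bullet> v = v"
    and vpaste_vunit_top: "\<alpha> \<in> Cells A \<Longrightarrow> vunit A (ctop A \<alpha>) \<sslash> \<alpha> = \<alpha>"
    and vpaste_vunit_bot: "\<alpha> \<in> Cells A \<Longrightarrow> \<alpha> \<sslash> vunit A (cbot A \<alpha>) = \<alpha>"
    and asc_globular: "\<lbrakk>u \<in> Ver A; v \<in> Ver A; w \<in> Ver A; vcod A u = vdom A v; vcod A v = vdom A w\<rbrakk>
      \<Longrightarrow> globular A ((w \<bullet> v) \<bullet> u) (w \<bullet> (v \<bullet> u)) (asc A w v u)"
    and asc'_globular: "\<lbrakk>u \<in> Ver A; v \<in> Ver A; w \<in> Ver A; vcod A u = vdom A v; vcod A v = vdom A w\<rbrakk>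
      \<Longrightarrow> globular A (w \<bullet> (v \<bullet> u)) ((w \<bullet> v) \<bullet> u) (asc' A w v u)"
    and asc_asc': "\<lbrakk>u \<in> Ver A; v \<in> Ver A; w \<in> Ver A; vcod A u = vdom A v; vcod A v = vdom A w\<rbrakk>
      \<Longrightarrow> asc A w v u \<parallel> asc' A w v u = hunit A ((w \<bullet> v) \<bullet> u)"
    and asc'_asc: "\<lbrakk>u \<in> Ver A; v \<in> Ver A; w \<in> Ver A; vcod A u = vdom A v; vcod A v = vdom A w\<rbrakk>
      \<Longrightarrow> asc' A w v u \<parallel> asc A w v u = hunit A (w \<bullet> (v \<bullet> u))"
    and asc_natural: "\<lbrakk>\<alpha> \<in> Cells A; \<beta> \<in> Cells A; \<gamma> \<in> Cells A;
        cbot A \<alpha> = ctop A \<beta>; cbot A \<beta> = ctop A \<gamma>\<rbrakk>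
      \<Longrightarrow> (\<alpha> \<sslash> (\<beta> \<sslash> \<gamma>)) \<parallel> asc A (cright A \<gamma>) (cright A \<beta>) (cright A \<alpha>)
        = asc A (cleft A \<gamma>) (cleft A \<beta>) (cleft A \<alpha>) \<parallel> ((\<alpha> \<sslash> \<beta>) \<sslash> \<gamma>)"
    and pentagon: "\<lbrakk>t \<in> Ver A; u \<in> Ver A; v \<in> Ver A; w \<in> Ver A;
        vcod A t = vdom A u; vcod A u = vdom A v; vcod A v = vdom A w\<rbrakk>
      \<Longrightarrow> asc A (w \<bullet> v) u t \<parallel> asc A w v (u \<bullet> t)
        = (hunit A t \<sslash> asc A w v u) \<parallel> asc A w (v \<bullet> u) t \<parallel> (asc A v u t \<sslash> hunit A w)"
    and triangle: "\<lbrakk>u \<in> Ver A; w \<in> Ver A; vcod A u = vdom A w\<rbrakk>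
      \<Longrightarrow> asc A w (vid A (vcod A u)) u = hunit A (w \<bullet> u)"
begin

definition is_conjoint :: "'h \<Rightarrow> 'v \<Rightarrow> 'c \<Rightarrow> 'c \<Rightarrow> bool" where
  "is_conjoint f s \<alpha> \<beta> \<longleftrightarrow>
     s \<in> Ver A \<and> vdom A s = hcod A f \<and> vcod A s = hdom A f \<and>
     cell A f (vid A (hdom A f)) s (hone A (hdom A f)) \<alpha> \<and>
     cell A (hone A (hcod A f)) s (vid A (hcod A f)) f \<beta> \<and>
     \<alpha> \<parallel> \<beta> = vunit A f \<and> \<beta> \<sslash> \<alpha> = hunit A s"

definition is_right_hom :: "'v \<Rightarrow> 'v \<Rightarrow> 'v \<Rightarrow> 'c \<Rightarrow> bool" where
  "is_right_hom x z r \<epsilon> \<longleftrightarrow>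
     r \<in> Ver A \<and> vdom A r = vcod A x \<and> vcod A r = vcod A z \<and>
     globular A (r \<bullet> x) z \<epsilon> \<and>
     (\<forall>g y \<alpha>. g \<in> Hor A \<and> hcod A g = vcod A z \<and>
        y \<in> Ver A \<and> vdom A y = vcod A x \<and> vcod A y = hdom A g \<and>
        cell A (hone A (vdom A x)) (y \<bullet> x) z g \<alpha>
        \<longrightarrow> (\<exists>!\<beta>. cell A (hone A (vcod A x)) y r g \<beta> \<and> (hunit A x \<sslash> \<beta>) \<parallel> \<epsilon> = \<alpha>))"

end

locale with_conjoints = double_category A
  for A :: "('o, 'h, 'v, 'c) dblcat" (structure) +
  fixes star :: "'h \<Rightarrow> 'v"  ("_\<^sup>\<star>" [1000] 999)
    and \<alpha>\<alpha> \<beta>\<beta> :: "'h \<Rightarrow> 'c"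
  assumes conjoint: "f \<in> Hor A \<Longrightarrow> is_conjoint f (f\<^sup>\<star>) (\<alpha>\<alpha> f) (\<beta>\<beta> f)"
    and star_hone: "a \<in> Obj A \<Longrightarrow> (hone A a)\<^sup>\<star> = vid A a"
begin

text \<open>The canonical isomorphism \<open>(h \<cdot> f)\<^sup>\<star> \<Rightarrow> f\<^sup>\<star> \<bullet> h\<^sup>\<star>\<close> and its inverse.\<close>

definition split :: "'h \<Rightarrow> 'h \<Rightarrow> 'c" where
  "split h f = \<beta>\<beta> (h \<cdot> f) \<sslash> ((vunit A f \<parallel> \<alpha>\<alpha> h) \<sslash> \<alpha>\<alpha> f)"

definition join :: "'h \<Rightarrow> 'h \<Rightarrow> 'c" where
  "join h f = (\<beta>\<beta> h \<sslash> (\<beta>\<beta> f \<parallel> vunit A h)) \<sslash> \<alpha>\<alpha> (h \<cdot> f)"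

definition coretrocell :: "'h \<Rightarrow> 'v \<Rightarrow> 'v \<Rightarrow> 'h \<Rightarrow> 'c \<Rightarrow> bool" where
  "coretrocell f v w g \<alpha> \<longleftrightarrow>
     f \<in> Hor A \<and> hdom A f = vdom A v \<and> hcod A f = vdom A w \<and>
     g \<in> Hor A \<and> hdom A g = vcod A v \<and> hcod A g = vcod A w \<and>
     v \<in> Ver A \<and> w \<in> Ver A \<and> globular A (g\<^sup>\<star> \<bullet> w) (v \<bullet> f\<^sup>\<star>) \<alpha>"

text \<open>
  The identity coretrocell on \<open>v\<close> is the canonical isomorphism \<open>1\<^sup>\<star> \<bullet> v \<Rightarrow> v \<bullet> 1\<^sup>\<star>\<close>. Both sides
  equal \<open>v\<close>, and it is \<open>hunit v\<close> as soon as the chosen binding cells of the conjoints of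
  identities are identity cells; the locale only normalises the vertical arrow \<open>1\<^sup>\<star>\<close>.
\<close>

definition coretro_id :: "'v \<Rightarrow> 'c" where
  "coretro_id v = (hunit A v \<sslash> \<beta>\<beta> (hone A (vcod A v))) \<parallel> (\<alpha>\<alpha> (hone A (vdom A v)) \<sslash> hunit A v)"

text \<open>
  Horizontal composite of the coretrocell \<open>\<alpha>\<close> (top \<open>f\<close>, left \<open>v\<close>, right \<open>w\<close>, bottom \<open>g\<close>) with
  \<open>\<beta>\<close> (top \<open>h\<close>, left \<open>w\<close>, right \<open>x\<close>, bottom \<open>k\<close>), associativity isomorphisms included.
\<close>

definition coretro_comp ::
  "'h \<Rightarrow> 'v \<Rightarrow> 'v \<Rightarrow> 'h \<Rightarrow> 'c \<Rightarrow> 'h \<Rightarrow> 'v \<Rightarrow> 'h \<Rightarrow> 'c \<Rightarrow> 'c" where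
  "coretro_comp f v w g \<alpha> h x k \<beta> =
     (hunit A x \<sslash> split k g)
     \<parallel> asc A (g\<^sup>\<star>) (k\<^sup>\<star>) x
     \<parallel> (\<beta> \<sslash> hunit A (g\<^sup>\<star>))
     \<parallel> asc' A (g\<^sup>\<star>) w (h\<^sup>\<star>)
     \<parallel> (hunit A (h\<^sup>\<star>) \<sslash> \<alpha>)
     \<parallel> asc A v (f\<^sup>\<star>) (h\<^sup>\<star>)
     \<parallel> (join h f \<sslash> hunit A v)"

end

text \<open>
  A morphism of \<open>TS\<close> carries its source and target spans; the remaining fields are the
  horizontal arrows \<open>a\<close>, \<open>b\<close>, \<open>c\<close>, the coretrocell and the cell.
\<close>

record ('h, 'v, 'c) ts_arrow =
  src :: "'v \<times> 'v"
  tgt :: "'v \<times> 'v"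
  ar_a :: 'h
  ar_b :: 'h
  ar_c :: 'h
  co :: 'c
  ce :: 'c

context with_conjoints
begin

definition TS :: "('v \<times> 'v, ('h, 'v, 'c) ts_arrow) cat_data" where
  "TS = \<lparr>
     Ob = {(x, z). x \<in> Ver A \<and> z \<in> Ver A \<and> vdom A x = vdom A z},
     Ar = {m. \<exists>x z x' z' a b c \<alpha> \<gamma>.
       m = \<lparr>src = (x, z), tgt = (x', z'), ar_a = a, ar_b = b, ar_c = c, co = \<alpha>, ce = \<gamma>\<rparr> \<and>
       x \<in> Ver A \<and> z \<in> Ver A \<and> vdom A x = vdom A z \<and>
       x' \<in> Ver A \<and> z' \<in> Ver A \<and> vdom A x' = vdom A z' \<and>
       coretrocell a x x' b \<alpha> \<and> cell A a z z' c \<gamma>},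
     Dom = src,
     Cod = tgt,
     Id = (\<lambda>(x, z). \<lparr>src = (x, z), tgt = (x, z),
       ar_a = hone A (vdom A x), ar_b = hone A (vcod A x), ar_c = hone A (vcod A z),
       co = coretro_id x, ce = hunit A z\<rparr>),
     Comp = (\<lambda>n m. \<lparr>src = src m, tgt = tgt n,
       ar_a = ar_a n \<cdot> ar_a m, ar_b = ar_b n \<cdot> ar_b m, ar_c = ar_c n \<cdot> ar_c m,
       co = coretro_comp (ar_a m) (fst (src m)) (fst (tgt m)) (ar_b m) (co m)
              (ar_a n) (fst (tgt n)) (ar_b n) (co n),
       ce = ce m \<parallel> ce n\<rparr>)\<rparr>"

end

locale right_closed = double_category A
  for A :: "('o, 'h, 'v, 'c) dblcat" (structure) +
  fixes rhom :: "'v \<Rightarrow> 'v \<Rightarrow> 'v"  (* rhom z x is the right hom z/x *)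
    and ev :: "'v \<Rightarrow> 'v \<Rightarrow> 'c"
  assumes right_hom: "\<lbrakk>x \<in> Ver A; z \<in> Ver A; vdom A x = vdom A z\<rbrakk>
      \<Longrightarrow> is_right_hom x z (rhom z x) (ev z x)"

locale right_closed_with_conjoints =
  with_conjoints A star \<alpha>\<alpha> \<beta>\<beta> + right_closed A rhom ev
  for A :: "('o, 'h, 'v, 'c) dblcat" (structure)
    and star :: "'h \<Rightarrow> 'v"  ("_\<^sup>\<star>" [1000] 999)
    and \<alpha>\<alpha> \<beta>\<beta> :: "'h \<Rightarrow> 'c"
    and rhom :: "'v \<Rightarrow> 'v \<Rightarrow> 'v"
    and ev :: "'v \<Rightarrow> 'v \<Rightarrow> 'c"
begin

definition rhom_ob :: "'v \<times> 'v \<Rightarrow> 'v" where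
  "rhom_ob = (\<lambda>(x, z). rhom z x)"

definition induced :: "('h, 'v, 'c) ts_arrow \<Rightarrow> 'c \<Rightarrow> bool" where
  "induced m \<xi> \<longleftrightarrow>
     (case (src m, tgt m) of ((x, z), (x', z')) \<Rightarrow>
        cell A (ar_b m) (rhom z x) (rhom z' x') (ar_c m) \<xi> \<and>
        (hunit A x' \<sslash> (\<beta>\<beta> (ar_b m) \<sslash> \<xi>)) \<parallel> ev z' x' =
          asc A (rhom z x) ((ar_b m)\<^sup>\<star>) x'
          \<parallel> (co m \<sslash> hunit A (rhom z x))
          \<parallel> asc' A (rhom z x) x ((ar_a m)\<^sup>\<star>)
          \<parallel> (hunit A ((ar_a m)\<^sup>\<star>) \<sslash> ev z x)
          \<parallel> (\<beta>\<beta> (ar_a m) \<sslash> ce m))"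

definition rhom_ar :: "('h, 'v, 'c) ts_arrow \<Rightarrow> 'c" where
  "rhom_ar m = (THE \<xi>. induced m \<xi>)"

end

end

theory Submission
  imports Defs
begin

text \<open>
  A cell \<open>\<xi>\<close> with top \<open>b\<close> and left side \<open>z/x\<close> is the same thing as a cell with identity top and left
  side \<open>(z/x) \<bullet> b\<^sup>\<star>\<close>, by transposition along the conjoint of \<open>b\<close> (\<open>conjoint_transpose\<close>). The
  universal property of \<open>z'/x'\<close> therefore has exactly one solution \<open>\<xi>\<close> for the equation that defines
  the action on a morphism, and functoriality amounts to checking that identity cells solve the
  equation for identities (\<open>hom_action_id\<close>) and that \<open>\<xi> \<parallel> \<theta>\<close> solves it for a composite when \<open>\<xi>\<close> and
  \<open>\<theta>\<close> solve it for the factors (\<open>hom_action_comp\<close>).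

  The idea behind the computation is that a coretrocell is a square of vertical arrows, that is, a
  globular cell \<open>P \<bullet> w \<Rightarrow> v \<bullet> Q\<close>, and that composition of coretrocells is pasting of such squares up to
  the comparison of \<open>(h \<cdot> f)\<^sup>\<star>\<close> with \<open>f\<^sup>\<star> \<bullet> h\<^sup>\<star>\<close>. The evaluation cell \<open>(z/x) \<bullet> x \<Rightarrow> z\<close> is also such a
  square, with \<open>Q\<close> an identity, and the right-hand side of the equation defining \<open>\<xi>\<close> is the pasting of
  the coretrocell with the evaluation square, followed by a cell. So a single associativity law for
  pasting squares, \<open>slide_assoc\<close>, yields both the associativity of composition of coretrocells and the
  compatibility of the action with composition.

  What remains is coherence of the comparison cells \<open>split\<close> and \<open>join\<close>. The arrow \<open>f\<^sup>\<star> \<bullet> h\<^sup>\<star>\<close> is itself a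
  conjoint of \<open>h \<cdot> f\<close> (\<open>conjoint_composite\<close>), a globular cell into a conjoint is determined by its
  composite with the binding cell \<open>\<beta>\<close> (\<open>conjoint_factor\<close>), and \<open>join h f\<close> carries one binding cell to
  the other. The chosen binding cells of an identity arrow need not be identity cells; they are
  mutually inverse globular cells on an identity, and these cancel in all the unit laws.
\<close>

section \<open>Boundaries, units and whiskering\<close>

context double_category
begin

text \<open>
  The simplification rules below are oriented for the simplifier: boundaries of pastings are computed from
  the boundaries of their parts, which discharges the composability conditions of the other rules;
  horizontal pastings are nested to the right, and whiskering is distributed over them.
\<close>

lemma cell_rules [simp]:
  assumes "\<alpha> \<in> Cells A"
  shows cleft_in: "cleft A \<alpha> \<in> Ver A" and cright_in: "cright A \<alpha> \<in> Ver A"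
    and ctop_in: "ctop A \<alpha> \<in> Hor A" and cbot_in: "cbot A \<alpha> \<in> Hor A"
    and hdom_ctop: "hdom A (ctop A \<alpha>) = vdom A (cleft A \<alpha>)"
    and hcod_ctop: "hcod A (ctop A \<alpha>) = vdom A (cright A \<alpha>)"
    and hdom_cbot: "hdom A (cbot A \<alpha>) = vcod A (cleft A \<alpha>)"
    and hcod_cbot: "hcod A (cbot A \<alpha>) = vcod A (cright A \<alpha>)"
  using assms is_functor.map_Ar[OF vsource] is_functor.map_Ar[OF vtarget]
    is_functor.map_Dom[OF vsource] is_functor.map_Dom[OF vtarget]
    is_functor.map_Cod[OF vsource] is_functor.map_Cod[OF vtarget]
    category.Dom_in[OF is_functor.axioms(1)[OF vsource]]
    category.Cod_in[OF is_functor.axioms(1)[OF vsource]]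
  by (simp_all add: A1_def A0_def)

lemma hor_rules [simp]:
  shows hdom_in: "f \<in> Hor A \<Longrightarrow> hdom A f \<in> Obj A"
    and hcod_in: "f \<in> Hor A \<Longrightarrow> hcod A f \<in> Obj A"
    and hone_in: "a \<in> Obj A \<Longrightarrow> hone A a \<in> Hor A"
    and hdom_hone: "a \<in> Obj A \<Longrightarrow> hdom A (hone A a) = a"
    and hcod_hone: "a \<in> Obj A \<Longrightarrow> hcod A (hone A a) = a"
    and hcomp_in: "\<lbrakk>f \<in> Hor A; g \<in> Hor A; hcod A f = hdom A g\<rbrakk> \<Longrightarrow> g \<cdot> f \<in> Hor A"
    and hdom_hcomp: "\<lbrakk>f \<in> Hor A; g \<in> Hor A; hcod A f = hdom A g\<rbrakk> \<Longrightarrow> hdom A (g \<cdot> f) = hdom A f"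
    and hcod_hcomp: "\<lbrakk>f \<in> Hor A; g \<in> Hor A; hcod A f = hdom A g\<rbrakk> \<Longrightarrow> hcod A (g \<cdot> f) = hcod A g"
    and hcomp_hone_right: "\<lbrakk>f \<in> Hor A; hdom A f = a\<rbrakk> \<Longrightarrow> f \<cdot> hone A a = f"
    and hcomp_hone_left: "\<lbrakk>f \<in> Hor A; hcod A f = a\<rbrakk> \<Longrightarrow> hone A a \<cdot> f = f"
  using category.Dom_in[OF is_functor.axioms(2)[OF vsource]]
    category.Cod_in[OF is_functor.axioms(2)[OF vsource]]
    category.Id_in[OF is_functor.axioms(2)[OF vsource]]
    category.Dom_Id[OF is_functor.axioms(2)[OF vsource]]
    category.Cod_Id[OF is_functor.axioms(2)[OF vsource]]
    category.Comp_in[OF is_functor.axioms(2)[OF vsource]]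
    category.Dom_Comp[OF is_functor.axioms(2)[OF vsource]]
    category.Cod_Comp[OF is_functor.axioms(2)[OF vsource]]
    category.Comp_Id_right[OF is_functor.axioms(2)[OF vsource]]
    category.Comp_Id_left[OF is_functor.axioms(2)[OF vsource]]
  by (auto simp: A0_def)

lemma hcomp_assoc:
  "\<lbrakk>f \<in> Hor A; g \<in> Hor A; h \<in> Hor A; hcod A f = hdom A g; hcod A g = hdom A h\<rbrakk>
    \<Longrightarrow> h \<cdot> g \<cdot> f = h \<cdot> (g \<cdot> f)"
  using category.Comp_assoc[OF is_functor.axioms(2)[OF vsource]] by (simp add: A0_def)

lemma ver_rules [simp]:
  shows vdom_in: "v \<in> Ver A \<Longrightarrow> vdom A v \<in> Obj A"
    and vcod_in: "v \<in> Ver A \<Longrightarrow> vcod A v \<in> Obj A"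
    and vid_in: "a \<in> Obj A \<Longrightarrow> vid A a \<in> Ver A"
    and vcomp_vid_right': "\<lbrakk>v \<in> Ver A; vdom A v = a\<rbrakk> \<Longrightarrow> v \<bullet> vid A a = v"
    and vcomp_vid_left': "\<lbrakk>v \<in> Ver A; vcod A v = a\<rbrakk> \<Longrightarrow> vid A a \<bullet> v = v"
  using is_functor.map_Ob[OF vsource] is_functor.map_Ob[OF vtarget]
    is_functor.map_Ob[OF videntity] vcomp_vid_left vcomp_vid_right
  by (auto simp: A0_def A1_def)

declare vdom_vid [simp] vcod_vid [simp] vcomp_in [simp] vdom_vcomp [simp] vcod_vcomp [simp]

lemma hpaste_rules [simp]:
  assumes "\<alpha> \<in> Cells A" "\<beta> \<in> Cells A" "cright A \<alpha> = cleft A \<beta>"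
  shows hpaste_in: "\<alpha> \<parallel> \<beta> \<in> Cells A"
    and cleft_hpaste: "cleft A (\<alpha> \<parallel> \<beta>) = cleft A \<alpha>"
    and cright_hpaste: "cright A (\<alpha> \<parallel> \<beta>) = cright A \<beta>"
    and ctop_hpaste: "ctop A (\<alpha> \<parallel> \<beta>) = ctop A \<beta> \<cdot> ctop A \<alpha>"
    and cbot_hpaste: "cbot A (\<alpha> \<parallel> \<beta>) = cbot A \<beta> \<cdot> cbot A \<alpha>"
  using assms
    category.Comp_in[OF is_functor.axioms(1)[OF vsource]]
    category.Dom_Comp[OF is_functor.axioms(1)[OF vsource]]
    category.Cod_Comp[OF is_functor.axioms(1)[OF vsource]]
    is_functor.map_Comp[OF vsource] is_functor.map_Comp[OF vtarget]
  by (auto simp: A0_def A1_def)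

lemma hpaste_assoc [simp]:
  "\<lbrakk>\<alpha> \<in> Cells A; \<beta> \<in> Cells A; \<gamma> \<in> Cells A; cright A \<alpha> = cleft A \<beta>; cright A \<beta> = cleft A \<gamma>\<rbrakk>
    \<Longrightarrow> \<alpha> \<parallel> \<beta> \<parallel> \<gamma> = \<alpha> \<parallel> (\<beta> \<parallel> \<gamma>)"
  using category.Comp_assoc[OF is_functor.axioms(1)[OF vsource]] by (simp add: A1_def)

lemma hunit_rules [simp]:
  assumes "v \<in> Ver A"
  shows hunit_in: "hunit A v \<in> Cells A"
    and cleft_hunit: "cleft A (hunit A v) = v"
    and cright_hunit: "cright A (hunit A v) = v"
    and ctop_hunit: "ctop A (hunit A v) = hone A (vdom A v)"
    and cbot_hunit: "cbot A (hunit A v) = hone A (vcod A v)"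
  using assms
    category.Id_in[OF is_functor.axioms(1)[OF vsource]]
    category.Dom_Id[OF is_functor.axioms(1)[OF vsource]]
    category.Cod_Id[OF is_functor.axioms(1)[OF vsource]]
    is_functor.map_Id[OF vsource] is_functor.map_Id[OF vtarget]
  by (auto simp: A0_def A1_def)

lemma hpaste_hunit_right [simp]: "\<lbrakk>\<alpha> \<in> Cells A; cright A \<alpha> = v\<rbrakk> \<Longrightarrow> \<alpha> \<parallel> hunit A v = \<alpha>"
  and hpaste_hunit_left [simp]: "\<lbrakk>\<alpha> \<in> Cells A; cleft A \<alpha> = v\<rbrakk> \<Longrightarrow> hunit A v \<parallel> \<alpha> = \<alpha>"
  using category.Comp_Id_right[OF is_functor.axioms(1)[OF vsource]]
    category.Comp_Id_left[OF is_functor.axioms(1)[OF vsource]]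
  by (auto simp: A1_def)

lemma vunit_rules [simp]:
  assumes "f \<in> Hor A"
  shows vunit_in: "vunit A f \<in> Cells A"
    and cleft_vunit: "cleft A (vunit A f) = vid A (hdom A f)"
    and cright_vunit: "cright A (vunit A f) = vid A (hcod A f)"
  using assms is_functor.map_Ar[OF videntity] is_functor.map_Dom[OF videntity]
    is_functor.map_Cod[OF videntity]
  by (auto simp: A0_def A1_def)

declare ctop_vunit [simp] cbot_vunit [simp]

lemma vunit_hone [simp]: "a \<in> Obj A \<Longrightarrow> vunit A (hone A a) = hunit A (vid A a)"
  using is_functor.map_Id[OF videntity] by (simp add: A0_def A1_def)

lemma vunit_hcomp:
  "\<lbrakk>f \<in> Hor A; g \<in> Hor A; hcod A f = hdom A g\<rbrakk> \<Longrightarrow> vunit A (g \<cdot> f) = vunit A f \<parallel> vunit A g"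
  using is_functor.map_Comp[OF videntity] by (simp add: A0_def A1_def)

lemma vpaste_rules [simp]:
  assumes "\<alpha> \<in> Cells A" "\<beta> \<in> Cells A" "cbot A \<alpha> = ctop A \<beta>"
  shows vpaste_in: "\<alpha> \<sslash> \<beta> \<in> Cells A"
    and cleft_vpaste: "cleft A (\<alpha> \<sslash> \<beta>) = cleft A \<beta> \<bullet> cleft A \<alpha>"
    and cright_vpaste: "cright A (\<alpha> \<sslash> \<beta>) = cright A \<beta> \<bullet> cright A \<alpha>"
    and ctop_vpaste: "ctop A (\<alpha> \<sslash> \<beta>) = ctop A \<alpha>"
    and cbot_vpaste: "cbot A (\<alpha> \<sslash> \<beta>) = cbot A \<beta>"
  using assms vpaste_cell[of "ctop A \<alpha>" "cleft A \<alpha>" "cright A \<alpha>" "cbot A \<alpha>" \<alpha>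
      "cleft A \<beta>" "cright A \<beta>" "cbot A \<beta>" \<beta>]
  by (auto simp: cell_def)

lemma vpaste_hunit_vid [simp]:
  shows "\<lbrakk>\<alpha> \<in> Cells A; a \<in> Obj A; ctop A \<alpha> = hone A a\<rbrakk> \<Longrightarrow> hunit A (vid A a) \<sslash> \<alpha> = \<alpha>"
    and "\<lbrakk>\<alpha> \<in> Cells A; a \<in> Obj A; cbot A \<alpha> = hone A a\<rbrakk> \<Longrightarrow> \<alpha> \<sslash> hunit A (vid A a) = \<alpha>"
  using vpaste_vunit_top[of \<alpha>] vpaste_vunit_bot[of \<alpha>] by auto

lemma vpaste_vunit [simp]:
  shows "\<lbrakk>\<alpha> \<in> Cells A; ctop A \<alpha> = f\<rbrakk> \<Longrightarrow> vunit A f \<sslash> \<alpha> = \<alpha>"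
    and "\<lbrakk>\<alpha> \<in> Cells A; cbot A \<alpha> = f\<rbrakk> \<Longrightarrow> \<alpha> \<sslash> vunit A f = \<alpha>"
  using vpaste_vunit_top[of \<alpha>] vpaste_vunit_bot[of \<alpha>] by auto

declare vpaste_hunit [simp]

lemma asc_rules [simp]:
  assumes "u \<in> Ver A" "v \<in> Ver A" "w \<in> Ver A" "vcod A u = vdom A v" "vcod A v = vdom A w"
  shows asc_in: "asc A w v u \<in> Cells A"
    and cleft_asc: "cleft A (asc A w v u) = w \<bullet> v \<bullet> u"
    and cright_asc: "cright A (asc A w v u) = w \<bullet> (v \<bullet> u)"
    and ctop_asc: "ctop A (asc A w v u) = hone A (vdom A u)"
    and cbot_asc: "cbot A (asc A w v u) = hone A (vcod A w)"
    and asc'_in: "asc' A w v u \<in> Cells A"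
    and cleft_asc': "cleft A (asc' A w v u) = w \<bullet> (v \<bullet> u)"
    and cright_asc': "cright A (asc' A w v u) = w \<bullet> v \<bullet> u"
    and ctop_asc': "ctop A (asc' A w v u) = hone A (vdom A u)"
    and cbot_asc': "cbot A (asc' A w v u) = hone A (vcod A w)"
  using assms asc_globular[OF assms] asc'_globular[OF assms]
  by (auto simp: globular_def cell_def)

declare asc_asc' [simp] asc'_asc [simp]

lemma asc_asc'_assoc [simp]:
  assumes "u \<in> Ver A" "v \<in> Ver A" "w \<in> Ver A" "vcod A u = vdom A v" "vcod A v = vdom A w" "\<zeta> \<in> Cells A"
  shows "cleft A \<zeta> = w \<bullet> v \<bullet> u \<Longrightarrow> asc A w v u \<parallel> (asc' A w v u \<parallel> \<zeta>) = \<zeta>"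
    and "cleft A \<zeta> = w \<bullet> (v \<bullet> u) \<Longrightarrow> asc' A w v u \<parallel> (asc A w v u \<parallel> \<zeta>) = \<zeta>"
  using assms hpaste_assoc[of "asc A w v u" "asc' A w v u" \<zeta>, symmetric]
    hpaste_assoc[of "asc' A w v u" "asc A w v u" \<zeta>, symmetric]
  by simp_all

lemma asc_vid_mid [simp]:
  assumes "u \<in> Ver A" "w \<in> Ver A" "vcod A u = a" "vdom A w = a"
  shows "asc A w (vid A a) u = hunit A (w \<bullet> u)"
  using triangle[of u w] assms by simp

text \<open>
  Kelly's argument: the pentagon whose two arrows composed last are identities reduces, by the triangle
  axiom, to the statement that this associativity cell is idempotent; an invertible idempotent is an
  identity. The mirror image, with the identities composed first, follows in the same way.
\<close>

lemma asc_vid_left [simp]: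
  assumes [simp]: "u \<in> Ver A" "v \<in> Ver A" "vcod A u = vdom A v" and a [simp]: "vcod A v = a"
  shows "asc A (vid A a) v u = hunit A (v \<bullet> u)"
proof -
  have [simp]: "a \<in> Obj A" using vcod_in[of v] by (simp del: vcod_in)
  have "asc A (vid A a) v u = asc A (vid A a) v u \<parallel> asc A (vid A a) v u"
    using pentagon[of u v "vid A a" "vid A a"] by simp
  then have "asc A (vid A a) v u \<parallel> asc' A (vid A a) v u
      = asc A (vid A a) v u \<parallel> asc A (vid A a) v u \<parallel> asc' A (vid A a) v u" by simp
  then show ?thesis by simp
qed

lemma asc_vid_right [simp]:
  assumes [simp]: "v \<in> Ver A" "w \<in> Ver A" "vcod A v = vdom A w" and a [simp]: "vdom A v = a"
  shows "asc A w v (vid A a) = hunit A (w \<bullet> v)"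
proof -
  have [simp]: "a \<in> Obj A" using vdom_in[of v] by (simp del: vdom_in)
  have "asc A w v (vid A a) = asc A w v (vid A a) \<parallel> asc A w v (vid A a)"
    using pentagon[of "vid A a" "vid A a" v w] by simp
  then have "asc A w v (vid A a) \<parallel> asc' A w v (vid A a)
      = asc A w v (vid A a) \<parallel> asc A w v (vid A a) \<parallel> asc' A w v (vid A a)" by simp
  then show ?thesis by simp
qed

lemma asc'_vid [simp]:
  shows "\<lbrakk>u \<in> Ver A; w \<in> Ver A; vcod A u = a; vdom A w = a\<rbrakk> \<Longrightarrow> asc' A w (vid A a) u = hunit A (w \<bullet> u)"
    and "\<lbrakk>u \<in> Ver A; v \<in> Ver A; vcod A u = vdom A v; vcod A v = a\<rbrakk>
      \<Longrightarrow> asc' A (vid A a) v u = hunit A (v \<bullet> u)"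
    and "\<lbrakk>v \<in> Ver A; w \<in> Ver A; vcod A v = vdom A w; vdom A v = a\<rbrakk>
      \<Longrightarrow> asc' A w v (vid A a) = hunit A (w \<bullet> v)"
  using asc_asc'[of u "vid A a" w] asc_asc'[of u v "vid A a"] asc_asc'[of "vid A a" v w]
    vcod_in[of u] vcod_in[of v] vdom_in[of v]
  by (auto simp del: asc_asc' vcod_in vdom_in)

definition vert :: "'v \<Rightarrow> 'o \<Rightarrow> 'o \<Rightarrow> bool" where
  "vert v a b \<longleftrightarrow> v \<in> Ver A \<and> vdom A v = a \<and> vcod A v = b"

lemma vertD:
  assumes "vert v a b"
  shows "v \<in> Ver A" "vdom A v = a" "vcod A v = b" "a \<in> Obj A" "b \<in> Obj A"
  using assms vdom_in[of v] vcod_in[of v] by (auto simp: vert_def simp del: vdom_in vcod_in)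

lemma cellD:
  assumes "cell A f v w g \<alpha>"
  shows "\<alpha> \<in> Cells A" "ctop A \<alpha> = f" "cleft A \<alpha> = v" "cright A \<alpha> = w" "cbot A \<alpha> = g"
  using assms by (auto simp: cell_def)

text \<open>
  Pastings are nested to the right, so an equation between two-cell pastings has to be restated in
  this form before it can rewrite inside a longer chain.
\<close>

lemma hpaste_eq_extend:
  assumes "\<alpha> \<parallel> \<beta> = \<gamma> \<parallel> \<delta>"
    and "\<alpha> \<in> Cells A" "\<beta> \<in> Cells A" "\<gamma> \<in> Cells A" "\<delta> \<in> Cells A" "\<zeta> \<in> Cells A"
    and "cright A \<alpha> = cleft A \<beta>" "cright A \<gamma> = cleft A \<delta>" "cright A \<beta> = cleft A \<zeta>"
      "cright A \<delta> = cleft A \<zeta>"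
  shows "\<alpha> \<parallel> (\<beta> \<parallel> \<zeta>) = \<gamma> \<parallel> (\<delta> \<parallel> \<zeta>)"
  using assms hpaste_assoc[of \<alpha> \<beta> \<zeta>] hpaste_assoc[of \<gamma> \<delta> \<zeta>] by simp

lemma hpaste_vpaste_hunit [simp]:
  assumes "\<alpha> \<in> Cells A" "\<beta> \<in> Cells A" "w \<in> Ver A" "cright A \<alpha> = cleft A \<beta>"
    and "cbot A \<alpha> = hone A (vdom A w)" "cbot A \<beta> = hone A (vdom A w)"
  shows "(\<alpha> \<parallel> \<beta>) \<sslash> hunit A w = (\<alpha> \<sslash> hunit A w) \<parallel> (\<beta> \<sslash> hunit A w)"
  using interchange[of \<alpha> \<beta> "hunit A w" "hunit A w"] assms by simp

lemma hunit_vpaste_hpaste [simp]: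
  assumes "\<alpha> \<in> Cells A" "\<beta> \<in> Cells A" "v \<in> Ver A" "cright A \<alpha> = cleft A \<beta>"
    and "ctop A \<alpha> = hone A (vcod A v)" "ctop A \<beta> = hone A (vcod A v)"
  shows "hunit A v \<sslash> (\<alpha> \<parallel> \<beta>) = (hunit A v \<sslash> \<alpha>) \<parallel> (hunit A v \<sslash> \<beta>)"
  using interchange[of "hunit A v" "hunit A v" \<alpha> \<beta>] assms by simp

text \<open>
  The two forms of the pentagon that occur when a chain is traversed against the direction of one of
  the associativity cells.
\<close>

lemma pentagon_rotated:
  assumes t: "vert t a b" and u: "vert u b c" and v: "vert v c d" and w: "vert w d e"
  shows "asc A w v (u \<bullet> t) \<parallel> (asc' A v u t \<sslash> hunit A w)
      = asc' A (w \<bullet> v) u t \<parallel> ((hunit A t \<sslash> asc A w v u) \<parallel> asc A w (v \<bullet> u) t)"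
    and "asc A w (v \<bullet> u) t \<parallel> ((asc A v u t \<sslash> hunit A w) \<parallel> asc' A w v (u \<bullet> t))
      = (hunit A t \<sslash> asc' A w v u) \<parallel> asc A (w \<bullet> v) u t"
proof -
  note [simp] = vertD[OF t] vertD[OF u] vertD[OF v] vertD[OF w]
  have P: "asc A (w \<bullet> v) u t \<parallel> asc A w v (u \<bullet> t)
      = (hunit A t \<sslash> asc A w v u) \<parallel> (asc A w (v \<bullet> u) t \<parallel> (asc A v u t \<sslash> hunit A w))"
    using pentagon[of t u v w] by simp
  have 1: "(asc A v u t \<sslash> hunit A w) \<parallel> (asc' A v u t \<sslash> hunit A w) = hunit A (w \<bullet> (v \<bullet> u \<bullet> t))"
    using hpaste_vpaste_hunit[of "asc A v u t" "asc' A v u t" w] by (simp del: hpaste_vpaste_hunit)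
  have 2: "(hunit A t \<sslash> asc' A w v u) \<parallel> (hunit A t \<sslash> asc A w v u) = hunit A (w \<bullet> (v \<bullet> u) \<bullet> t)"
    using hunit_vpaste_hpaste[of "asc' A w v u" "asc A w v u" t] by (simp del: hunit_vpaste_hpaste)
  have "asc A w v (u \<bullet> t) \<parallel> (asc' A v u t \<sslash> hunit A w)
      = asc' A (w \<bullet> v) u t \<parallel> ((asc A (w \<bullet> v) u t \<parallel> asc A w v (u \<bullet> t)) \<parallel> (asc' A v u t \<sslash> hunit A w))"
    by simp
  also have "\<dots> = asc' A (w \<bullet> v) u t \<parallel> ((hunit A t \<sslash> asc A w v u) \<parallel> asc A w (v \<bullet> u) t)"
    unfolding P using 1 by simp
  finally show "asc A w v (u \<bullet> t) \<parallel> (asc' A v u t \<sslash> hunit A w)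
      = asc' A (w \<bullet> v) u t \<parallel> ((hunit A t \<sslash> asc A w v u) \<parallel> asc A w (v \<bullet> u) t)" .
  have "asc A w (v \<bullet> u) t \<parallel> ((asc A v u t \<sslash> hunit A w) \<parallel> asc' A w v (u \<bullet> t))
      = ((hunit A t \<sslash> asc' A w v u) \<parallel> (hunit A t \<sslash> asc A w v u))
        \<parallel> (asc A w (v \<bullet> u) t \<parallel> ((asc A v u t \<sslash> hunit A w) \<parallel> asc' A w v (u \<bullet> t)))"
    by (subst 2) simp
  also have "\<dots> = (hunit A t \<sslash> asc' A w v u)
        \<parallel> (((hunit A t \<sslash> asc A w v u) \<parallel> (asc A w (v \<bullet> u) t \<parallel> (asc A v u t \<sslash> hunit A w))) \<parallel> asc' A w v (u \<bullet> t))"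
    by simp
  also have "\<dots> = (hunit A t \<sslash> asc' A w v u) \<parallel> asc A (w \<bullet> v) u t"
    unfolding P[symmetric] by simp
  finally show "asc A w (v \<bullet> u) t \<parallel> ((asc A v u t \<sslash> hunit A w) \<parallel> asc' A w v (u \<bullet> t))
      = (hunit A t \<sslash> asc' A w v u) \<parallel> asc A (w \<bullet> v) u t" .
qed

lemma asc'_natural:
  assumes "\<alpha> \<in> Cells A" "\<beta> \<in> Cells A" "\<gamma> \<in> Cells A" "cbot A \<alpha> = ctop A \<beta>" "cbot A \<beta> = ctop A \<gamma>"
  shows "((\<alpha> \<sslash> \<beta>) \<sslash> \<gamma>) \<parallel> asc' A (cright A \<gamma>) (cright A \<beta>) (cright A \<alpha>)
        = asc' A (cleft A \<gamma>) (cleft A \<beta>) (cleft A \<alpha>) \<parallel> (\<alpha> \<sslash> (\<beta> \<sslash> \<gamma>))"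
proof -
  note [simp] = assms
  have [simp]: "vdom A (cleft A \<beta>) = vcod A (cleft A \<alpha>)" "vdom A (cright A \<beta>) = vcod A (cright A \<alpha>)"
    "vdom A (cleft A \<gamma>) = vcod A (cleft A \<beta>)" "vdom A (cright A \<gamma>) = vcod A (cright A \<beta>)"
    using assms hdom_cbot[of \<alpha>] hcod_cbot[of \<alpha>] hdom_cbot[of \<beta>] hcod_cbot[of \<beta>]
     hdom_ctop[of \<gamma>] hcod_ctop[of \<gamma>] hdom_ctop[of \<beta>] hcod_ctop[of \<beta>] by metis+
  have "((\<alpha> \<sslash> \<beta>) \<sslash> \<gamma>) \<parallel> asc' A (cright A \<gamma>) (cright A \<beta>) (cright A \<alpha>)
     = asc' A (cleft A \<gamma>) (cleft A \<beta>) (cleft A \<alpha>) \<parallel>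
     ((asc A (cleft A \<gamma>) (cleft A \<beta>) (cleft A \<alpha>) \<parallel>
       ((\<alpha> \<sslash> \<beta>) \<sslash> \<gamma>)) \<parallel> asc' A (cright A \<gamma>) (cright A \<beta>) (cright A \<alpha>))"
    by simp
  also have "\<dots> = asc' A (cleft A \<gamma>) (cleft A \<beta>) (cleft A \<alpha>) \<parallel> (\<alpha> \<sslash> (\<beta> \<sslash> \<gamma>))"
    by (subst asc_natural[symmetric]) simp_all
  finally show ?thesis .
qed

end

section \<open>Pasting squares of vertical arrows\<close>

context double_category
begin

text \<open>
  A globular cell \<open>\<beta>\<close> from \<open>P' \<bullet> x\<close> to \<open>w \<bullet> Q\<close> is read as a square that moves \<open>x\<close> through to \<open>w\<close>. The pasting
  \<open>slide\<close> applies it above \<open>P\<close> and then \<open>\<alpha>\<close>, whose left side is \<open>P \<bullet> w\<close>, below \<open>Q\<close>. The right side and the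
  bottom of \<open>\<alpha>\<close> are left unconstrained so that the definition covers evaluation cells followed by
  arbitrary cells as well as squares.
\<close>

definition slide :: "'v \<Rightarrow> 'v \<Rightarrow> 'v \<Rightarrow> 'c \<Rightarrow> 'v \<Rightarrow> 'v \<Rightarrow> 'c \<Rightarrow> 'c" where
  "slide P P' x \<beta> w Q \<alpha> =
     asc A P P' x \<parallel> ((\<beta> \<sslash> hunit A P) \<parallel> (asc' A P w Q \<parallel> (hunit A Q \<sslash> \<alpha>)))"

lemma slide_cell:
  assumes x: "vert x a' b'" and w: "vert w a b" and P': "vert P' b' b" and Q: "vert Q a' a"
    and P: "vert P b c"
    and \<beta>: "globular A (P' \<bullet> x) (w \<bullet> Q) \<beta>" and \<alpha>: "cell A (hone A a) (P \<bullet> w) t g \<alpha>"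
  shows "cell A (hone A a') (P \<bullet> P' \<bullet> x) (t \<bullet> Q) g (slide P P' x \<beta> w Q \<alpha>)"
proof -
  note [simp] = vertD[OF x] vertD[OF w] vertD[OF P'] vertD[OF Q] vertD[OF P]
    cellD[OF \<beta>[unfolded globular_def]] cellD[OF \<alpha>]
  show ?thesis
    using hdom_cbot[of \<alpha>] cbot_in[of \<alpha>] by (simp add: slide_def cell_def del: hdom_cbot)
qed

text \<open>
  Three pentagons and three naturality squares. Each of the steps \<open>e1\<close> to \<open>e6\<close> pushes an
  associativity cell further to the right; applied in this order they turn the
  left-hand side into the right-hand side.
\<close>

lemma slide_assoc:
  assumes y: "vert y a3 b3" and x: "vert x a2 b2" and w: "vert w a1 b1"
    and P: "vert P b1 c" and P': "vert P' b2 b1" and P'': "vert P'' b3 b2"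
    and Q': "vert Q' a2 a1" and Q'': "vert Q'' a3 a2"
    and \<delta>: "globular A (P'' \<bullet> y) (x \<bullet> Q'') \<delta>"
    and \<beta>: "globular A (P' \<bullet> x) (w \<bullet> Q') \<beta>"
    and \<alpha>: "cell A (hone A a1) (P \<bullet> w) t g \<alpha>"
  shows "(hunit A y \<sslash> asc A P P' P'')
      \<parallel> slide P (P' \<bullet> P'') y (slide P' P'' y \<delta> x Q'' \<beta> \<parallel> asc A w Q' Q'') w (Q' \<bullet> Q'') \<alpha>
    = slide (P \<bullet> P') P'' y \<delta> x Q'' (slide P P' x \<beta> w Q' \<alpha>) \<parallel> asc A t Q' Q''"
proof -
  note [simp] = vertD[OF y] vertD[OF x] vertD[OF w] vertD[OF P] vertD[OF P'] vertD[OF P'']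
    vertD[OF Q'] vertD[OF Q'']
    cellD[OF \<delta>[unfolded globular_def]] cellD[OF \<beta>[unfolded globular_def]] cellD[OF \<alpha>]
  have [simp]: "t \<in> Ver A" "vdom A t = a1" "g \<in> Hor A" "hcod A g = vcod A t" "hdom A g = c"
    using hcod_ctop[of \<alpha>] cright_in[of \<alpha>] cbot_in[of \<alpha>] hcod_cbot[of \<alpha>] hdom_cbot[of \<alpha>]
    by (simp_all del: hcod_ctop cright_in cbot_in hcod_cbot hdom_cbot)
  \<comment> \<open>The tail \<open>\<zeta>\<close> stands for the remaining factors of the chain.\<close>
  have e1: "(hunit A y \<sslash> asc A P P' P'') \<parallel> (asc A P (P' \<bullet> P'') y \<parallel> ((asc A P' P'' y \<sslash> hunit A P) \<parallel> \<zeta>))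
      = asc A (P \<bullet> P') P'' y \<parallel> (asc A P P' (P'' \<bullet> y) \<parallel> \<zeta>)"
    if [simp]: "\<zeta> \<in> Cells A" "cleft A \<zeta> = P \<bullet> (P' \<bullet> (P'' \<bullet> y))" for \<zeta>
    using arg_cong[OF pentagon[of y P'' P' P], of "\<lambda>\<theta>. \<theta> \<parallel> \<zeta>"] by simp
  have e2: "asc A P P' (P'' \<bullet> y) \<parallel> (((\<delta> \<sslash> hunit A P') \<sslash> hunit A P) \<parallel> \<zeta>)
      = (\<delta> \<sslash> hunit A (P \<bullet> P')) \<parallel> (asc A P P' (x \<bullet> Q'') \<parallel> \<zeta>)"
    if [simp]: "\<zeta> \<in> Cells A" "cleft A \<zeta> = P \<bullet> (P' \<bullet> (x \<bullet> Q''))" for \<zeta>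
    using arg_cong[OF asc_natural[of \<delta> "hunit A P'" "hunit A P"], of "\<lambda>\<theta>. \<theta> \<parallel> \<zeta>"] by simp
  have e3: "asc A P P' (x \<bullet> Q'') \<parallel> ((asc' A P' x Q'' \<sslash> hunit A P) \<parallel> \<zeta>)
      = asc' A (P \<bullet> P') x Q'' \<parallel> ((hunit A Q'' \<sslash> asc A P P' x) \<parallel> (asc A P (P' \<bullet> x) Q'' \<parallel> \<zeta>))"
    if [simp]: "\<zeta> \<in> Cells A" "cleft A \<zeta> = P \<bullet> (P' \<bullet> x \<bullet> Q'')" for \<zeta>
    using arg_cong[OF pentagon_rotated(1)[OF Q'' x P' P], of "\<lambda>\<theta>. \<theta> \<parallel> \<zeta>"] by simp
  have e4: "asc A P (P' \<bullet> x) Q'' \<parallel> (((hunit A Q'' \<sslash> \<beta>) \<sslash> hunit A P) \<parallel> \<zeta>)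
      = (hunit A Q'' \<sslash> (\<beta> \<sslash> hunit A P)) \<parallel> (asc A P (w \<bullet> Q') Q'' \<parallel> \<zeta>)"
    if [simp]: "\<zeta> \<in> Cells A" "cleft A \<zeta> = P \<bullet> (w \<bullet> Q' \<bullet> Q'')" for \<zeta>
    using arg_cong[OF asc_natural[of "hunit A Q''" \<beta> "hunit A P"], of "\<lambda>\<theta>. \<theta> \<parallel> \<zeta>"] by simp
  have e5: "asc A P (w \<bullet> Q') Q'' \<parallel> ((asc A w Q' Q'' \<sslash> hunit A P) \<parallel> (asc' A P w (Q' \<bullet> Q'') \<parallel> \<zeta>))
      = (hunit A Q'' \<sslash> asc' A P w Q') \<parallel> (asc A (P \<bullet> w) Q' Q'' \<parallel> \<zeta>)"
    if [simp]: "\<zeta> \<in> Cells A" "cleft A \<zeta> = P \<bullet> w \<bullet> (Q' \<bullet> Q'')" for \<zeta>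
    using arg_cong[OF pentagon_rotated(2)[OF Q'' Q' w P], of "\<lambda>\<theta>. \<theta> \<parallel> \<zeta>"] by simp
  have e6: "asc A (P \<bullet> w) Q' Q'' \<parallel> (hunit A (Q' \<bullet> Q'') \<sslash> \<alpha>)
      = (hunit A Q'' \<sslash> (hunit A Q' \<sslash> \<alpha>)) \<parallel> asc A t Q' Q''"
    using asc_natural[of "hunit A Q''" "hunit A Q'" \<alpha>] by simp
  show ?thesis
    by (simp add: slide_def e1 e2 e3 e4 e5 e6)
qed

lemma slide_postcomp:
  assumes x: "vert x a' b'" and w: "vert w a b" and P': "vert P' b' b" and Q: "vert Q a' a"
    and P: "vert P b c" and \<beta>: "globular A (P' \<bullet> x) (w \<bullet> Q) \<beta>"
    and \<alpha>: "cell A (hone A a) (P \<bullet> w) t g \<alpha>" and \<zeta>: "cell A (hone A a) t t' k \<zeta>"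
  shows "slide P P' x \<beta> w Q (\<alpha> \<parallel> \<zeta>) = slide P P' x \<beta> w Q \<alpha> \<parallel> (hunit A Q \<sslash> \<zeta>)"
proof -
  note [simp] = vertD[OF x] vertD[OF w] vertD[OF P'] vertD[OF Q] vertD[OF P]
    cellD[OF \<beta>[unfolded globular_def]] cellD[OF \<alpha>] cellD[OF \<zeta>]
  show ?thesis by (simp add: slide_def)
qed

text \<open>
  A cell \<open>\<omega>\<close> acting on \<open>P\<close> occupies places disjoint from the square \<open>\<beta>\<close>, so interchange lets it pass to the
  cell \<open>\<alpha>\<close>. Here \<open>\<omega>\<close> may have any bottom, since it is applied to transposes of the induced cells.
\<close>

lemma slide_precomp:
  assumes x: "vert x a' b'" and w: "vert w a b" and P': "vert P' b' b" and Q: "vert Q a' a"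
    and P: "vert P b c" and R: "vert R b d" and \<beta>: "globular A (P' \<bullet> x) (w \<bullet> Q) \<beta>"
    and \<omega>: "cell A (hone A b) P R k \<omega>" and \<alpha>: "cell A (hone A a) (R \<bullet> w) t g \<alpha>"
  shows "(hunit A x \<sslash> (hunit A P' \<sslash> \<omega>)) \<parallel> slide R P' x \<beta> w Q \<alpha>
    = slide P P' x \<beta> w Q ((hunit A w \<sslash> \<omega>) \<parallel> \<alpha>)"
proof -
  note [simp] = vertD[OF x] vertD[OF w] vertD[OF P'] vertD[OF Q] vertD[OF P] vertD[OF R]
    cellD[OF \<beta>[unfolded globular_def]] cellD[OF \<alpha>] cellD[OF \<omega>]
  have e1: "(hunit A x \<sslash> (hunit A P' \<sslash> \<omega>)) \<parallel> (asc A R P' x \<parallel> \<zeta>)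
      = asc A P P' x \<parallel> ((hunit A (P' \<bullet> x) \<sslash> \<omega>) \<parallel> \<zeta>)"
    if [simp]: "\<zeta> \<in> Cells A" "cleft A \<zeta> = R \<bullet> (P' \<bullet> x)" for \<zeta>
    using arg_cong[OF asc_natural[of "hunit A x" "hunit A P'" \<omega>], of "\<lambda>\<theta>. \<theta> \<parallel> \<zeta>"] by simp
  have "(hunit A (P' \<bullet> x) \<sslash> \<omega>) \<parallel> (\<beta> \<sslash> hunit A R) = (\<beta> \<sslash> hunit A P) \<parallel> (hunit A (w \<bullet> Q) \<sslash> \<omega>)"
    using interchange[of "hunit A (P' \<bullet> x)" \<beta> \<omega> "hunit A R"]
      interchange[of \<beta> "hunit A (w \<bullet> Q)" "hunit A P" \<omega>] by simp
  then have e2: "(hunit A (P' \<bullet> x) \<sslash> \<omega>) \<parallel> ((\<beta> \<sslash> hunit A R) \<parallel> \<zeta>)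
      = (\<beta> \<sslash> hunit A P) \<parallel> ((hunit A (w \<bullet> Q) \<sslash> \<omega>) \<parallel> \<zeta>)"
    if "\<zeta> \<in> Cells A" "cleft A \<zeta> = R \<bullet> (w \<bullet> Q)" for \<zeta>
    using that by (intro hpaste_eq_extend) simp_all
  have e3: "(hunit A (w \<bullet> Q) \<sslash> \<omega>) \<parallel> (asc' A R w Q \<parallel> \<zeta>)
      = asc' A P w Q \<parallel> ((hunit A Q \<sslash> (hunit A w \<sslash> \<omega>)) \<parallel> \<zeta>)"
    if [simp]: "\<zeta> \<in> Cells A" "cleft A \<zeta> = R \<bullet> w \<bullet> Q" for \<zeta>
    using arg_cong[OF asc'_natural[of "hunit A Q" "hunit A w" \<omega>], of "\<lambda>\<theta>. \<theta> \<parallel> \<zeta>"] by simp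
  show ?thesis by (simp add: slide_def e1 e2 e3)
qed

text \<open>
  Changing the sides \<open>P'\<close> and \<open>Q\<close> of the square \<open>\<beta>\<close> along globular cells commutes with pasting. This is how
  the comparison cells of conjoints are moved out of a pasting.
\<close>

lemma slide_whisker:
  assumes x: "vert x a' b'" and w: "vert w a b" and P': "vert P' b' b" and Q: "vert Q a' a"
    and P: "vert P b c" and P1: "vert P1 b' b" and Q1: "vert Q1 a' a"
    and \<beta>: "globular A (P' \<bullet> x) (w \<bullet> Q) \<beta>"
    and \<sigma>: "globular A P1 P' \<sigma>" and \<tau>: "globular A Q Q1 \<tau>"
    and \<alpha>: "cell A (hone A a) (P \<bullet> w) t g \<alpha>"
  shows "slide P P1 x ((hunit A x \<sslash> \<sigma>) \<parallel> \<beta> \<parallel> (\<tau> \<sslash> hunit A w)) w Q1 \<alpha>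
    = (hunit A x \<sslash> (\<sigma> \<sslash> hunit A P)) \<parallel> slide P P' x \<beta> w Q \<alpha> \<parallel> (\<tau> \<sslash> hunit A t)"
proof -
  note [simp] = vertD[OF x] vertD[OF w] vertD[OF P'] vertD[OF Q] vertD[OF P] vertD[OF P1] vertD[OF Q1]
    cellD[OF \<beta>[unfolded globular_def]] cellD[OF \<alpha>] cellD[OF \<sigma>[unfolded globular_def]]
    cellD[OF \<tau>[unfolded globular_def]]
  have [simp]: "t \<in> Ver A" "vdom A t = a" "g \<in> Hor A" "hcod A g = vcod A t" "hdom A g = c"
    using hcod_ctop[of \<alpha>] cright_in[of \<alpha>] cbot_in[of \<alpha>] hcod_cbot[of \<alpha>] hdom_cbot[of \<alpha>]
    by (simp_all del: hcod_ctop cright_in cbot_in hcod_cbot hdom_cbot)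
  have e1: "asc A P P1 x \<parallel> (((hunit A x \<sslash> \<sigma>) \<sslash> hunit A P) \<parallel> \<zeta>)
      = (hunit A x \<sslash> (\<sigma> \<sslash> hunit A P)) \<parallel> (asc A P P' x \<parallel> \<zeta>)"
    if [simp]: "\<zeta> \<in> Cells A" "cleft A \<zeta> = P \<bullet> (P' \<bullet> x)" for \<zeta>
    using arg_cong[OF asc_natural[of "hunit A x" \<sigma> "hunit A P"], of "\<lambda>\<theta>. \<theta> \<parallel> \<zeta>"] by simp
  have e2: "((\<tau> \<sslash> hunit A w) \<sslash> hunit A P) \<parallel> (asc' A P w Q1 \<parallel> \<zeta>)
      = asc' A P w Q \<parallel> ((\<tau> \<sslash> hunit A (P \<bullet> w)) \<parallel> \<zeta>)"
    if [simp]: "\<zeta> \<in> Cells A" "cleft A \<zeta> = P \<bullet> w \<bullet> Q1" for \<zeta>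
    using arg_cong[OF asc'_natural[of \<tau> "hunit A w" "hunit A P"], of "\<lambda>\<theta>. \<theta> \<parallel> \<zeta>"] by simp
  have e3: "(\<tau> \<sslash> hunit A (P \<bullet> w)) \<parallel> (hunit A Q1 \<sslash> \<alpha>) = (hunit A Q \<sslash> \<alpha>) \<parallel> (\<tau> \<sslash> hunit A t)"
    using interchange[of \<tau> "hunit A Q1" "hunit A (P \<bullet> w)" \<alpha>]
      interchange[of "hunit A Q" \<tau> \<alpha> "hunit A t"] by simp
  show ?thesis by (simp add: slide_def e1 e2 e3)
qed

lemma slide_unit:
  assumes w: "vert w a b" and P: "vert P b c" and \<alpha>: "cell A (hone A a) (P \<bullet> w) t g \<alpha>"
  shows "slide P (vid A b) w (hunit A w) w (vid A a) \<alpha> = \<alpha>"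
proof -
  note [simp] = vertD[OF w] vertD[OF P] cellD[OF \<alpha>]
  show ?thesis by (simp add: slide_def)
qed

lemma slide_onto_unit:
  assumes x: "vert x a' b'" and w: "vert w a b" and P': "vert P' b' b" and Q: "vert Q a' a"
    and \<beta>: "globular A (P' \<bullet> x) (w \<bullet> Q) \<beta>"
  shows "slide (vid A b) P' x \<beta> w Q (hunit A w) = \<beta>"
proof -
  note [simp] = vertD[OF x] vertD[OF w] vertD[OF P'] vertD[OF Q]
    cellD[OF \<beta>[unfolded globular_def]]
  show ?thesis by (simp add: slide_def)
qed

text \<open>
  When \<open>\<alpha>\<close> is a square from \<open>P \<bullet> w\<close> to \<open>v \<bullet> Q\<close>, a final associativity cell makes the result a square with
  sides \<open>P \<bullet> P'\<close> and \<open>Q \<bullet> Q'\<close>.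
\<close>

definition square_comp :: "'v \<Rightarrow> 'v \<Rightarrow> 'v \<Rightarrow> 'c \<Rightarrow> 'v \<Rightarrow> 'v \<Rightarrow> 'v \<Rightarrow> 'v \<Rightarrow> 'c \<Rightarrow> 'c" where
  "square_comp P P' x \<beta> w v Q Q' \<alpha> = slide P P' x \<beta> w Q' \<alpha> \<parallel> asc A v Q Q'"

lemma square_comp_globular:
  assumes x: "vert x a2 b2" and w: "vert w a1 b1" and v: "vert v a0 b0"
    and P: "vert P b1 b0" and P': "vert P' b2 b1" and Q: "vert Q a1 a0" and Q': "vert Q' a2 a1"
    and \<beta>: "globular A (P' \<bullet> x) (w \<bullet> Q') \<beta>" and \<alpha>: "globular A (P \<bullet> w) (v \<bullet> Q) \<alpha>"
  shows "globular A (P \<bullet> P' \<bullet> x) (v \<bullet> (Q \<bullet> Q')) (square_comp P P' x \<beta> w v Q Q' \<alpha>)"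
proof -
  note [simp] = vertD[OF x] vertD[OF w] vertD[OF v] vertD[OF P] vertD[OF P'] vertD[OF Q] vertD[OF Q']
  have \<alpha>': "cell A (hone A a1) (P \<bullet> w) (v \<bullet> Q) (hone A b0) \<alpha>"
    using \<alpha> by (simp add: globular_def)
  note [simp] = cellD[OF slide_cell[OF x w P' Q' P \<beta> \<alpha>']]
  show ?thesis by (simp add: square_comp_def globular_def cell_def)
qed

text \<open>
  The associativity law for \<open>slide\<close>, combined with one more pentagon for the final associativity cells.
\<close>

lemma square_comp_assoc:
  assumes y: "vert y a3 b3" and x: "vert x a2 b2" and w: "vert w a1 b1" and v: "vert v a0 b0"
    and P: "vert P b1 b0" and P': "vert P' b2 b1" and P'': "vert P'' b3 b2"
    and Q: "vert Q a1 a0" and Q': "vert Q' a2 a1" and Q'': "vert Q'' a3 a2"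
    and \<delta>: "globular A (P'' \<bullet> y) (x \<bullet> Q'') \<delta>"
    and \<beta>: "globular A (P' \<bullet> x) (w \<bullet> Q') \<beta>"
    and \<alpha>: "globular A (P \<bullet> w) (v \<bullet> Q) \<alpha>"
  shows "(hunit A y \<sslash> asc A P P' P'')
      \<parallel> square_comp P (P' \<bullet> P'') y (square_comp P' P'' y \<delta> x w Q' Q'' \<beta>) w v Q (Q' \<bullet> Q'') \<alpha>
    = square_comp (P \<bullet> P') P'' y \<delta> x v (Q \<bullet> Q') Q'' (square_comp P P' x \<beta> w v Q Q' \<alpha>)
      \<parallel> (asc A Q Q' Q'' \<sslash> hunit A v)"
proof -
  note [simp] = vertD[OF x] vertD[OF w] vertD[OF v] vertD[OF P] vertD[OF P'] vertD[OF Q] vertD[OF Q']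
    vertD[OF y] vertD[OF P''] vertD[OF Q'']
  have vs [simp]: "vert (P \<bullet> P') b2 b0" "vert (P' \<bullet> P'') b3 b1" "vert (Q' \<bullet> Q'') a3 a1" "vert (Q \<bullet> Q') a2 a0"
    by (simp_all add: vert_def)
  have \<alpha>': "cell A (hone A a1) (P \<bullet> w) (v \<bullet> Q) (hone A b0) \<alpha>"
    using \<alpha> by (simp add: globular_def)
  note sa = slide_cell[OF x w P' Q' P \<beta> \<alpha>']
  have as: "cell A (hone A a2) (v \<bullet> Q \<bullet> Q') (v \<bullet> (Q \<bullet> Q')) (hone A b0) (asc A v Q Q')"
    by (simp add: cell_def)
  note [simp] = cellD[OF slide_cell[OF y x P'' Q'' vs(1) \<delta> sa]]
  have bd: "globular A (P' \<bullet> P'' \<bullet> y) (w \<bullet> (Q' \<bullet> Q'')) (square_comp P' P'' y \<delta> x w Q' Q'' \<beta>)"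
    by (rule square_comp_globular[OF y x w P' P'' Q' Q'' \<delta> \<beta>])
  note [simp] = cellD[OF slide_cell[OF y w vs(2,3) P bd \<alpha>']]
  have "(hunit A y \<sslash> asc A P P' P'')
      \<parallel> square_comp P (P' \<bullet> P'') y (square_comp P' P'' y \<delta> x w Q' Q'' \<beta>) w v Q (Q' \<bullet> Q'') \<alpha>
    = ((hunit A y \<sslash> asc A P P' P'') \<parallel> slide P (P' \<bullet> P'') y (square_comp P' P'' y \<delta> x w Q' Q'' \<beta>) w (Q' \<bullet> Q'') \<alpha>)
      \<parallel> asc A v Q (Q' \<bullet> Q'')"
    by (simp add: square_comp_def[where w = w and v = v])
  also have "(hunit A y \<sslash> asc A P P' P'') \<parallel> slide P (P' \<bullet> P'') y (square_comp P' P'' y \<delta> x w Q' Q'' \<beta>) w (Q' \<bullet> Q'') \<alpha>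
    = slide (P \<bullet> P') P'' y \<delta> x Q'' (slide P P' x \<beta> w Q' \<alpha>) \<parallel> asc A (v \<bullet> Q) Q' Q''"
    unfolding square_comp_def by (rule slide_assoc[OF y x w P P' P'' Q' Q'' \<delta> \<beta> \<alpha>'])
  also have "(slide (P \<bullet> P') P'' y \<delta> x Q'' (slide P P' x \<beta> w Q' \<alpha>) \<parallel> asc A (v \<bullet> Q) Q' Q'') \<parallel> asc A v Q (Q' \<bullet> Q'')
    = (slide (P \<bullet> P') P'' y \<delta> x Q'' (slide P P' x \<beta> w Q' \<alpha>) \<parallel> (hunit A Q'' \<sslash> asc A v Q Q'))
      \<parallel> (asc A v (Q \<bullet> Q') Q'' \<parallel> (asc A Q Q' Q'' \<sslash> hunit A v))"
    using pentagon[of Q'' Q' Q v] by simp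
  also have "slide (P \<bullet> P') P'' y \<delta> x Q'' (slide P P' x \<beta> w Q' \<alpha>) \<parallel> (hunit A Q'' \<sslash> asc A v Q Q')
    = slide (P \<bullet> P') P'' y \<delta> x Q'' (square_comp P P' x \<beta> w v Q Q' \<alpha>)"
    unfolding square_comp_def by (rule slide_postcomp[OF y x P'' Q'' vs(1) \<delta> sa as, symmetric])
  finally show ?thesis
    using slide_postcomp[OF y x P'' Q'' vs(1) \<delta> sa as] by (simp add: square_comp_def)
qed

lemma square_comp_whisker_right:
  assumes x: "vert x a2 b2" and w: "vert w a1 b1" and v: "vert v a0 b0"
    and P: "vert P b1 b0" and P': "vert P' b2 b1" and Q: "vert Q a1 a0" and Q': "vert Q' a2 a1"
    and P1: "vert P1 b2 b1" and Q1: "vert Q1 a2 a1"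
    and \<beta>: "globular A (P' \<bullet> x) (w \<bullet> Q') \<beta>" and \<alpha>: "globular A (P \<bullet> w) (v \<bullet> Q) \<alpha>"
    and \<sigma>: "globular A P1 P' \<sigma>" and \<tau>: "globular A Q' Q1 \<tau>"
  shows "square_comp P P1 x ((hunit A x \<sslash> \<sigma>) \<parallel> \<beta> \<parallel> (\<tau> \<sslash> hunit A w)) w v Q Q1 \<alpha>
    = (hunit A x \<sslash> (\<sigma> \<sslash> hunit A P)) \<parallel> square_comp P P' x \<beta> w v Q Q' \<alpha> \<parallel> ((\<tau> \<sslash> hunit A Q) \<sslash> hunit A v)"
proof -
  note [simp] = vertD[OF x] vertD[OF w] vertD[OF v] vertD[OF P] vertD[OF P'] vertD[OF Q] vertD[OF Q']
    vertD[OF P1] vertD[OF Q1]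
    cellD[OF \<sigma>[unfolded globular_def]] cellD[OF \<tau>[unfolded globular_def]]
  have \<alpha>': "cell A (hone A a1) (P \<bullet> w) (v \<bullet> Q) (hone A b0) \<alpha>"
    using \<alpha> by (simp add: globular_def)
  note [simp] = cellD[OF slide_cell[OF x w P' Q' P \<beta> \<alpha>']]
  show ?thesis
    using asc_natural[of \<tau> "hunit A Q" "hunit A v"]
    by (simp add: square_comp_def slide_whisker[OF x w P' Q' P P1 Q1 \<beta> \<sigma> \<tau> \<alpha>'] del: hpaste_vpaste_hunit)
qed

lemma square_comp_whisker_left:
  assumes x: "vert x a2 b2" and w: "vert w a1 b1" and v: "vert v a0 b0"
    and P: "vert P b1 b0" and P': "vert P' b2 b1" and Q: "vert Q a1 a0" and Q': "vert Q' a2 a1"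
    and P1: "vert P1 b1 b0" and Q1: "vert Q1 a1 a0"
    and \<beta>: "globular A (P' \<bullet> x) (w \<bullet> Q') \<beta>" and \<alpha>: "globular A (P \<bullet> w) (v \<bullet> Q) \<alpha>"
    and \<sigma>: "globular A P1 P \<sigma>" and \<tau>: "globular A Q Q1 \<tau>"
  shows "square_comp P1 P' x \<beta> w v Q1 Q' ((hunit A w \<sslash> \<sigma>) \<parallel> \<alpha> \<parallel> (\<tau> \<sslash> hunit A v))
    = (hunit A x \<sslash> (hunit A P' \<sslash> \<sigma>)) \<parallel> square_comp P P' x \<beta> w v Q Q' \<alpha> \<parallel> ((hunit A Q' \<sslash> \<tau>) \<sslash> hunit A v)"
proof -
  note [simp] = vertD[OF x] vertD[OF w] vertD[OF v] vertD[OF P] vertD[OF P'] vertD[OF Q] vertD[OF Q']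
    vertD[OF P1] vertD[OF Q1]
  have \<sigma>': "cell A (hone A b1) P1 P (hone A b0) \<sigma>" using \<sigma> by (simp add: globular_def)
  have \<alpha>': "cell A (hone A a1) (P \<bullet> w) (v \<bullet> Q) (hone A b0) \<alpha>"
    using \<alpha> by (simp add: globular_def)
  note [simp] = cellD[OF slide_cell[OF x w P' Q' P \<beta> \<alpha>']] cellD[OF \<sigma>'] cellD[OF \<tau>[unfolded globular_def]]
    cellD[OF \<alpha>']
  have s: "cell A (hone A a1) (P1 \<bullet> w) (v \<bullet> Q) (hone A b0) ((hunit A w \<sslash> \<sigma>) \<parallel> \<alpha>)"
    and t: "cell A (hone A a1) (v \<bullet> Q) (v \<bullet> Q1) (hone A b0) (\<tau> \<sslash> hunit A v)"
    by (simp_all add: cell_def)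
  have 1: "slide P1 P' x \<beta> w Q' ((hunit A w \<sslash> \<sigma>) \<parallel> \<alpha> \<parallel> (\<tau> \<sslash> hunit A v))
      = (hunit A x \<sslash> (hunit A P' \<sslash> \<sigma>)) \<parallel> slide P P' x \<beta> w Q' \<alpha> \<parallel> (hunit A Q' \<sslash> (\<tau> \<sslash> hunit A v))"
    unfolding slide_postcomp[OF x w P' Q' P1 \<beta> s t] slide_precomp[OF x w P' Q' P1 P \<beta> \<sigma>' \<alpha>'] by simp
  show ?thesis
    unfolding square_comp_def 1 using asc_natural[of "hunit A Q'" \<tau> "hunit A v"] by simp
qed

lemma square_comp_unit_right:
  assumes w: "vert w a1 b1" and v: "vert v a0 b0" and P: "vert P b1 b0" and Q: "vert Q a1 a0"
    and \<alpha>: "globular A (P \<bullet> w) (v \<bullet> Q) \<alpha>"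
  shows "square_comp P (vid A b1) w (hunit A w) w v Q (vid A a1) \<alpha> = \<alpha>"
proof -
  note [simp] = vertD[OF w] vertD[OF v] vertD[OF P] vertD[OF Q]
  have \<alpha>': "cell A (hone A a1) (P \<bullet> w) (v \<bullet> Q) (hone A b0) \<alpha>"
    using \<alpha> by (simp add: globular_def)
  then show ?thesis using slide_unit[OF w P \<alpha>'] cellD[OF \<alpha>'] by (simp add: square_comp_def)
qed

lemma square_comp_unit_left:
  assumes x: "vert x a1 b1" and v: "vert v a0 b0" and P: "vert P b1 b0" and Q: "vert Q a1 a0"
    and \<beta>: "globular A (P \<bullet> x) (v \<bullet> Q) \<beta>"
  shows "square_comp (vid A b0) P x \<beta> v v (vid A a0) Q (hunit A v) = \<beta>"
proof -
  note [simp] = vertD[OF x] vertD[OF v] vertD[OF P] vertD[OF Q] cellD[OF \<beta>[unfolded globular_def]]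
  show ?thesis using slide_onto_unit[OF x v P Q \<beta>] by (simp add: square_comp_def)
qed

end

section \<open>Conjoints of composites\<close>

context double_category
begin

lemma conjointD:
  assumes "is_conjoint f s \<alpha> \<beta>" "f \<in> Hor A"
  shows "s \<in> Ver A" "vdom A s = hcod A f" "vcod A s = hdom A f"
    "\<alpha> \<in> Cells A" "ctop A \<alpha> = f" "cleft A \<alpha> = vid A (hdom A f)" "cright A \<alpha> = s"
    "cbot A \<alpha> = hone A (hdom A f)"
    "\<beta> \<in> Cells A" "ctop A \<beta> = hone A (hcod A f)" "cleft A \<beta> = s" "cright A \<beta> = vid A (hcod A f)"
    "cbot A \<beta> = f"
    "\<alpha> \<parallel> \<beta> = vunit A f" "\<beta> \<sslash> \<alpha> = hunit A s"
  using assms by (simp_all add: is_conjoint_def cell_def)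

text \<open>
  A globular cell into a conjoint can be recovered from its composite with the binding cell \<open>\<beta>\<close>, because
  \<open>\<beta> \<sslash> \<alpha>\<close> is an identity cell. So such cells may be compared after
  pasting with \<open>\<beta>\<close>.
\<close>

lemma conjoint_factor:
  assumes c: "is_conjoint f s \<alpha> \<beta>" and f: "f \<in> Hor A" and \<sigma>: "globular A t s \<sigma>"
  shows "\<sigma> = (\<sigma> \<parallel> \<beta>) \<sslash> \<alpha>"
proof -
  note [simp] = conjointD[OF c f] cellD[OF \<sigma>[unfolded globular_def]] f
  have [simp]: "t \<in> Ver A" "vdom A t = hcod A f" "vcod A t = hdom A f"
    using hcod_ctop[of \<sigma>] cleft_in[of \<sigma>] hcod_cbot[of \<sigma>]
    by (simp_all del: hcod_ctop cleft_in hcod_cbot)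
  show ?thesis using interchange[of \<sigma> \<beta> "hunit A (vid A (hdom A f))" \<alpha>] by simp
qed

text \<open>
  Uniqueness of conjoints up to isomorphism: \<open>\<beta> \<sslash> \<alpha>'\<close> is the comparison cell, and the second equation
  characterises it. Both \<open>split\<close> and \<open>join\<close> are cells of this form.
\<close>

lemma conjoint_comparison:
  assumes c: "is_conjoint f s \<alpha> \<beta>" and c': "is_conjoint f s' \<alpha>' \<beta>'" and f: "f \<in> Hor A"
  shows "globular A s s' (\<beta> \<sslash> \<alpha>')" and "(\<beta> \<sslash> \<alpha>') \<parallel> \<beta>' = \<beta>" and "(\<beta> \<sslash> \<alpha>') \<parallel> (\<beta>' \<sslash> \<alpha>) = hunit A s"
proof -
  note [simp] = conjointD[OF c f] conjointD[OF c' f] f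
  show g: "globular A s s' (\<beta> \<sslash> \<alpha>')" by (simp add: globular_def cell_def)
  have k: "(\<gamma> \<sslash> \<delta>') \<parallel> \<delta> = \<gamma>"
    if "is_conjoint f u \<delta>' \<delta>" "is_conjoint f r \<gamma>' \<gamma>" for u r \<delta> \<delta>' \<gamma> \<gamma>'
  proof -
    note [simp] = conjointD[OF that(1) f] conjointD[OF that(2) f]
    show ?thesis using interchange[of \<gamma> "hunit A (vid A (hcod A f))" \<delta>' \<delta>] by simp
  qed
  show 1: "(\<beta> \<sslash> \<alpha>') \<parallel> \<beta>' = \<beta>" using c c' by (intro k)
  have 2: "(\<beta>' \<sslash> \<alpha>) \<parallel> \<beta> = \<beta>'" using c c' by (intro k)
  have "globular A s s ((\<beta> \<sslash> \<alpha>') \<parallel> (\<beta>' \<sslash> \<alpha>))" by (simp add: globular_def cell_def)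
  from conjoint_factor[OF c f this] 1 2
  show "(\<beta> \<sslash> \<alpha>') \<parallel> (\<beta>' \<sslash> \<alpha>) = hunit A s" by simp
qed

text \<open>
  Composing with a conjoint on the left side of a cell is the same as having its arrow on top: \<open>\<beta>\<close> turns
  a cell with top \<open>f\<close> into one with identity top, and \<open>\<alpha>\<close> turns it back.
\<close>

lemma conjoint_transpose:
  assumes c: "is_conjoint f s \<alpha> \<beta>" and f: "f \<in> Hor A" and r: "vert r (hdom A f) d"
    and \<zeta>: "cell A (hone A (hcod A f)) (r \<bullet> s) r' g \<zeta>"
  shows "cell A f r r' g \<xi> \<and> \<beta> \<sslash> \<xi> = \<zeta> \<longleftrightarrow> \<xi> = (\<alpha> \<sslash> hunit A r) \<parallel> \<zeta>"
proof -
  note [simp] = conjointD[OF c f] vertD[OF r] cellD[OF \<zeta>] f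
  show ?thesis
  proof (intro iffI conjI; (elim conjE)?)
    assume \<xi>: "cell A f r r' g \<xi>" and eq: "\<beta> \<sslash> \<xi> = \<zeta>"
    note [simp] = cellD[OF \<xi>]
    show "\<xi> = (\<alpha> \<sslash> hunit A r) \<parallel> \<zeta>"
      using interchange[of \<alpha> \<beta> "hunit A r" \<xi>] by (simp add: eq)
  next
    assume \<xi>: "\<xi> = (\<alpha> \<sslash> hunit A r) \<parallel> \<zeta>"
    have "g \<in> Hor A" "hdom A g = d" using cbot_in[of \<zeta>] hdom_cbot[of \<zeta>]
      by (simp_all del: cbot_in hdom_cbot)
    then show "cell A f r r' g \<xi>" by (simp add: cell_def \<xi>)
    have "\<beta> \<sslash> (\<alpha> \<sslash> hunit A r) = hunit A (r \<bullet> s)"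
      using asc_natural[of \<beta> \<alpha> "hunit A r"] by simp
    then show "\<beta> \<sslash> \<xi> = \<zeta>"
      using interchange[of \<beta> "hunit A (vid A (hcod A f))" "\<alpha> \<sslash> hunit A r" \<zeta>] by (simp add: \<xi>)
  qed
qed

end

context with_conjoints
begin

lemmas conjoint_rules [simp] = conjointD[OF conjoint]
declare star_hone [simp]

text \<open>
  The first identity is interchange. For the second, the two middle cells combine to \<open>\<beta>\<beta> f \<parallel> \<alpha>\<alpha> h\<close>, which is
  also the vertical pasting \<open>\<alpha>\<alpha> h \<sslash> \<beta>\<beta> f\<close>; the binding cells of \<open>h\<close> and those of \<open>f\<close> are then adjacent and
  cancel. All reassociations involve an identity and are therefore trivial.
\<close>

lemma conjoint_composite:
  assumes f [simp]: "f \<in> Hor A" and h [simp]: "h \<in> Hor A" and fh: "hcod A f = hdom A h"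
  shows "is_conjoint (h \<cdot> f) (f\<^sup>\<star> \<bullet> h\<^sup>\<star>) ((vunit A f \<parallel> \<alpha>\<alpha> h) \<sslash> \<alpha>\<alpha> f) (\<beta>\<beta> h \<sslash> (\<beta>\<beta> f \<parallel> vunit A h))"
proof -
  note [simp] = fh
  let ?X = "\<beta>\<beta> f \<parallel> vunit A h" and ?Y = "vunit A f \<parallel> \<alpha>\<alpha> h"
  have "(?Y \<sslash> \<alpha>\<alpha> f) \<parallel> (\<beta>\<beta> h \<sslash> ?X) = (?Y \<parallel> \<beta>\<beta> h) \<sslash> (\<alpha>\<alpha> f \<parallel> ?X)"
    using interchange[of ?Y "\<beta>\<beta> h" "\<alpha>\<alpha> f" ?X] by simp
  also have "?Y \<parallel> \<beta>\<beta> h = vunit A (h \<cdot> f)" by (simp add: vunit_hcomp)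
  also have "\<alpha>\<alpha> f \<parallel> ?X = vunit A (h \<cdot> f)"
    using hpaste_assoc[of "\<alpha>\<alpha> f" "\<beta>\<beta> f" "vunit A h"] by (simp add: vunit_hcomp del: hpaste_assoc)
  finally have 1: "(?Y \<sslash> \<alpha>\<alpha> f) \<parallel> (\<beta>\<beta> h \<sslash> ?X) = vunit A (h \<cdot> f)" by simp
  have "?X \<sslash> ?Y = \<beta>\<beta> f \<parallel> \<alpha>\<alpha> h"
    using interchange[of "\<beta>\<beta> f" "vunit A h" "vunit A f" "\<alpha>\<alpha> h"] by simp
  also have "\<dots> = \<alpha>\<alpha> h \<sslash> \<beta>\<beta> f"
    using interchange[of "hunit A (vid A (hcod A f))" "\<alpha>\<alpha> h" "\<beta>\<beta> f" "hunit A (vid A (hdom A h))"]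
    by simp
  finally have m: "?X \<sslash> ?Y = \<alpha>\<alpha> h \<sslash> \<beta>\<beta> f" .
  have "(\<beta>\<beta> h \<sslash> ?X) \<sslash> (?Y \<sslash> \<alpha>\<alpha> f) = ((\<beta>\<beta> h \<sslash> ?X) \<sslash> ?Y) \<sslash> \<alpha>\<alpha> f"
    using asc_natural[of "\<beta>\<beta> h \<sslash> ?X" ?Y "\<alpha>\<alpha> f"] by simp
  also have "(\<beta>\<beta> h \<sslash> ?X) \<sslash> ?Y = \<beta>\<beta> h \<sslash> (\<alpha>\<alpha> h \<sslash> \<beta>\<beta> f)"
    using asc_natural[of "\<beta>\<beta> h" ?X ?Y] by (simp add: m)
  also have "\<dots> = hunit A (h\<^sup>\<star>) \<sslash> \<beta>\<beta> f"
    using asc_natural[of "\<beta>\<beta> h" "\<alpha>\<alpha> h" "\<beta>\<beta> f"] by simp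
  also have "\<dots> \<sslash> \<alpha>\<alpha> f = hunit A (f\<^sup>\<star> \<bullet> h\<^sup>\<star>)"
    using asc_natural[of "hunit A (h\<^sup>\<star>)" "\<beta>\<beta> f" "\<alpha>\<alpha> f"] by simp
  finally have 2: "(\<beta>\<beta> h \<sslash> ?X) \<sslash> (?Y \<sslash> \<alpha>\<alpha> f) = hunit A (f\<^sup>\<star> \<bullet> h\<^sup>\<star>)" .
  from 1 2 show ?thesis by (simp add: is_conjoint_def cell_def)
qed

lemma split_join:
  assumes f: "f \<in> Hor A" and h: "h \<in> Hor A" and fh: "hcod A f = hdom A h"
  shows globular_split: "globular A ((h \<cdot> f)\<^sup>\<star>) (f\<^sup>\<star> \<bullet> h\<^sup>\<star>) (split h f)"
    and globular_join: "globular A (f\<^sup>\<star> \<bullet> h\<^sup>\<star>) ((h \<cdot> f)\<^sup>\<star>) (join h f)"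
    and split_hpaste_join: "split h f \<parallel> join h f = hunit A ((h \<cdot> f)\<^sup>\<star>)"
    and join_hpaste_split: "join h f \<parallel> split h f = hunit A (f\<^sup>\<star> \<bullet> h\<^sup>\<star>)"
    and split_hpaste_\<beta>\<beta>: "split h f \<parallel> (\<beta>\<beta> h \<sslash> (\<beta>\<beta> f \<parallel> vunit A h)) = \<beta>\<beta> (h \<cdot> f)"
    and join_hpaste_\<beta>\<beta>: "join h f \<parallel> \<beta>\<beta> (h \<cdot> f) = \<beta>\<beta> h \<sslash> (\<beta>\<beta> f \<parallel> vunit A h)"
proof -
  have hf: "h \<cdot> f \<in> Hor A" using f h fh by simp
  note c = conjoint[OF hf] conjoint_composite[OF f h fh]
  note 1 = conjoint_comparison[OF c hf] and 2 = conjoint_comparison[OF c(2,1) hf]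
  show "globular A ((h \<cdot> f)\<^sup>\<star>) (f\<^sup>\<star> \<bullet> h\<^sup>\<star>) (split h f)"
    "split h f \<parallel> join h f = hunit A ((h \<cdot> f)\<^sup>\<star>)"
    "split h f \<parallel> (\<beta>\<beta> h \<sslash> (\<beta>\<beta> f \<parallel> vunit A h)) = \<beta>\<beta> (h \<cdot> f)"
    using 1 by (simp_all add: split_def join_def)
  show "globular A (f\<^sup>\<star> \<bullet> h\<^sup>\<star>) ((h \<cdot> f)\<^sup>\<star>) (join h f)"
    "join h f \<parallel> split h f = hunit A (f\<^sup>\<star> \<bullet> h\<^sup>\<star>)"
    "join h f \<parallel> \<beta>\<beta> (h \<cdot> f) = \<beta>\<beta> h \<sslash> (\<beta>\<beta> f \<parallel> vunit A h)"
    using 2 by (simp_all add: split_def join_def)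
qed

lemma conjoint_cancel:
  assumes f: "f \<in> Hor A" and \<sigma>: "globular A t (f\<^sup>\<star>) \<sigma>" and \<tau>: "globular A t (f\<^sup>\<star>) \<tau>"
    and eq: "\<sigma> \<parallel> \<beta>\<beta> f = \<tau> \<parallel> \<beta>\<beta> f"
  shows "\<sigma> = \<tau>"
  using conjoint_factor[OF conjoint[OF f] f \<sigma>] conjoint_factor[OF conjoint[OF f] f \<tau>] eq by simp

text \<open>
  The chosen conjoint of an identity arrow has an identity as vertical arrow, but its binding cells
  remain, so \<open>join\<close> need not be an identity cell here.
\<close>

lemma join_hone_right:
  assumes h [simp]: "h \<in> Hor A" and a: "hdom A h = a"
  shows "join h (hone A a) = hunit A (h\<^sup>\<star>) \<sslash> \<beta>\<beta> (hone A a)"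
proof (rule conjoint_cancel[OF h])
  note [simp] = a
  have [simp]: "a \<in> Obj A" using hdom_in[OF h] by (simp del: hdom_in)
  show "globular A (h\<^sup>\<star>) (h\<^sup>\<star>) (join h (hone A a))"
    using globular_join[of "hone A a" h] by simp
  show "globular A (h\<^sup>\<star>) (h\<^sup>\<star>) (hunit A (h\<^sup>\<star>) \<sslash> \<beta>\<beta> (hone A a))"
    by (simp add: globular_def cell_def)
  show "join h (hone A a) \<parallel> \<beta>\<beta> h = (hunit A (h\<^sup>\<star>) \<sslash> \<beta>\<beta> (hone A a)) \<parallel> \<beta>\<beta> h"
    using join_hpaste_\<beta>\<beta>[of "hone A a" h] interchange[of "hunit A (h\<^sup>\<star>)" "\<beta>\<beta> h" "\<beta>\<beta> (hone A a)" "vunit A h"]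
    by simp
qed

lemma join_hone_left:
  assumes f [simp]: "f \<in> Hor A" and b: "hcod A f = b"
  shows "join (hone A b) f = \<beta>\<beta> (hone A b) \<sslash> hunit A (f\<^sup>\<star>)"
proof (rule conjoint_cancel[OF f])
  note [simp] = b
  have [simp]: "b \<in> Obj A" using hcod_in[OF f] by (simp del: hcod_in)
  show "globular A (f\<^sup>\<star>) (f\<^sup>\<star>) (join (hone A b) f)"
    using globular_join[of f "hone A b"] by simp
  show "globular A (f\<^sup>\<star>) (f\<^sup>\<star>) (\<beta>\<beta> (hone A b) \<sslash> hunit A (f\<^sup>\<star>))"
    by (simp add: globular_def cell_def)
  show "join (hone A b) f \<parallel> \<beta>\<beta> f = (\<beta>\<beta> (hone A b) \<sslash> hunit A (f\<^sup>\<star>)) \<parallel> \<beta>\<beta> f"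
    using join_hpaste_\<beta>\<beta>[of f "hone A b"]
      interchange[of "\<beta>\<beta> (hone A b)" "hunit A (vid A b)" "hunit A (f\<^sup>\<star>)" "\<beta>\<beta> f"]
    by simp
qed

text \<open>
  After pasting with the binding cell of the triple composite, both sides become the binding cell of the
  composite conjoint \<open>f\<^sup>\<star> \<bullet> h\<^sup>\<star> \<bullet> p\<^sup>\<star>\<close>.
\<close>

lemma join_assoc:
  assumes f [simp]: "f \<in> Hor A" and h [simp]: "h \<in> Hor A" and p [simp]: "p \<in> Hor A"
    and fh: "hcod A f = hdom A h" and hp: "hcod A h = hdom A p"
  shows "asc A (f\<^sup>\<star>) (h\<^sup>\<star>) (p\<^sup>\<star>) \<parallel> ((join p h \<sslash> hunit A (f\<^sup>\<star>)) \<parallel> join (p \<cdot> h) f)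
    = (hunit A (p\<^sup>\<star>) \<sslash> join h f) \<parallel> join p (h \<cdot> f)"
proof (rule conjoint_cancel)
  note [simp] = fh hp hcomp_assoc
  note [simp] = cellD[OF globular_join[unfolded globular_def]]
  show "p \<cdot> (h \<cdot> f) \<in> Hor A" by simp
  have j [simp]: "ctop A (join (p \<cdot> h) f) = hone A (hcod A p)" "cleft A (join (p \<cdot> h) f) = f\<^sup>\<star> \<bullet> (p \<cdot> h)\<^sup>\<star>"
    "cright A (join (p \<cdot> h) f) = (p \<cdot> (h \<cdot> f))\<^sup>\<star>" "cbot A (join (p \<cdot> h) f) = hone A (hdom A f)"
    "join (p \<cdot> h) f \<in> Cells A"
    using cellD[OF globular_join[of f "p \<cdot> h", unfolded globular_def]] by simp_all
  show "globular A (f\<^sup>\<star> \<bullet> h\<^sup>\<star> \<bullet> p\<^sup>\<star>) ((p \<cdot> (h \<cdot> f))\<^sup>\<star>)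
     (asc A (f\<^sup>\<star>) (h\<^sup>\<star>) (p\<^sup>\<star>) \<parallel> ((join p h \<sslash> hunit A (f\<^sup>\<star>)) \<parallel> join (p \<cdot> h) f))"
    by (simp add: globular_def cell_def)
  show "globular A (f\<^sup>\<star> \<bullet> h\<^sup>\<star> \<bullet> p\<^sup>\<star>) ((p \<cdot> (h \<cdot> f))\<^sup>\<star>)
     ((hunit A (p\<^sup>\<star>) \<sslash> join h f) \<parallel> join p (h \<cdot> f))"
    by (simp add: globular_def cell_def)
  \<comment> \<open>The common value of both sides.\<close>
  let ?b = "\<beta>\<beta> p \<sslash> ((\<beta>\<beta> h \<sslash> (\<beta>\<beta> f \<parallel> vunit A h)) \<parallel> vunit A p)"
  have J: "join (p \<cdot> h) f \<parallel> \<beta>\<beta> (p \<cdot> (h \<cdot> f)) = \<beta>\<beta> (p \<cdot> h) \<sslash> (\<beta>\<beta> f \<parallel> vunit A (p \<cdot> h))"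
    using join_hpaste_\<beta>\<beta>[of f "p \<cdot> h"] by simp
  have "(asc A (f\<^sup>\<star>) (h\<^sup>\<star>) (p\<^sup>\<star>) \<parallel> ((join p h \<sslash> hunit A (f\<^sup>\<star>)) \<parallel> join (p \<cdot> h) f)) \<parallel> \<beta>\<beta> (p \<cdot> (h \<cdot> f))
     = asc A (f\<^sup>\<star>) (h\<^sup>\<star>) (p\<^sup>\<star>) \<parallel> ((join p h \<sslash> hunit A (f\<^sup>\<star>)) \<parallel> (\<beta>\<beta> (p \<cdot> h) \<sslash> (\<beta>\<beta> f \<parallel> vunit A (p \<cdot> h))))"
    by (simp add: J)
  also have "(join p h \<sslash> hunit A (f\<^sup>\<star>)) \<parallel> (\<beta>\<beta> (p \<cdot> h) \<sslash> (\<beta>\<beta> f \<parallel> vunit A (p \<cdot> h)))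
     = (\<beta>\<beta> p \<sslash> (\<beta>\<beta> h \<parallel> vunit A p)) \<sslash> (\<beta>\<beta> f \<parallel> (vunit A h \<parallel> vunit A p))"
    using interchange[of "join p h" "\<beta>\<beta> (p \<cdot> h)" "hunit A (f\<^sup>\<star>)" "\<beta>\<beta> f \<parallel> vunit A (p \<cdot> h)"]
    by (simp add: join_hpaste_\<beta>\<beta> vunit_hcomp)
  also have "asc A (f\<^sup>\<star>) (h\<^sup>\<star>) (p\<^sup>\<star>) \<parallel> \<dots>
     = \<beta>\<beta> p \<sslash> ((\<beta>\<beta> h \<parallel> vunit A p) \<sslash> (\<beta>\<beta> f \<parallel> (vunit A h \<parallel> vunit A p)))"
    using asc_natural[of "\<beta>\<beta> p" "\<beta>\<beta> h \<parallel> vunit A p" "\<beta>\<beta> f \<parallel> (vunit A h \<parallel> vunit A p)"] by simp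
  also have "\<dots> = ?b"
    using interchange[of "\<beta>\<beta> h" "vunit A p" "\<beta>\<beta> f \<parallel> vunit A h" "vunit A p"] by simp
  also have "?b = \<beta>\<beta> p \<sslash> ((join h f \<parallel> \<beta>\<beta> (h \<cdot> f)) \<parallel> vunit A p)"
    by (simp only: join_hpaste_\<beta>\<beta> f h fh)
  also have "\<dots> = (hunit A (p\<^sup>\<star>) \<sslash> join h f) \<parallel> (\<beta>\<beta> p \<sslash> (\<beta>\<beta> (h \<cdot> f) \<parallel> vunit A p))"
    using interchange[of "hunit A (p\<^sup>\<star>)" "\<beta>\<beta> p" "join h f" "\<beta>\<beta> (h \<cdot> f) \<parallel> vunit A p"] by simp
  also have "\<dots> = ((hunit A (p\<^sup>\<star>) \<sslash> join h f) \<parallel> join p (h \<cdot> f)) \<parallel> \<beta>\<beta> (p \<cdot> (h \<cdot> f))"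
    by (simp add: join_hpaste_\<beta>\<beta>)
  finally show "(asc A (f\<^sup>\<star>) (h\<^sup>\<star>) (p\<^sup>\<star>) \<parallel> ((join p h \<sslash> hunit A (f\<^sup>\<star>)) \<parallel> join (p \<cdot> h) f)) \<parallel> \<beta>\<beta> (p \<cdot> (h \<cdot> f))
    = ((hunit A (p\<^sup>\<star>) \<sslash> join h f) \<parallel> join p (h \<cdot> f)) \<parallel> \<beta>\<beta> (p \<cdot> (h \<cdot> f))" .
qed

text \<open>
  Obtained from \<open>join_assoc\<close> by inverting both sides.
\<close>

lemma split_assoc:
  assumes f [simp]: "f \<in> Hor A" and h [simp]: "h \<in> Hor A" and p [simp]: "p \<in> Hor A"
    and fh: "hcod A f = hdom A h" and hp: "hcod A h = hdom A p"
  shows "split p (h \<cdot> f) \<parallel> ((hunit A (p\<^sup>\<star>) \<sslash> split h f) \<parallel> asc A (f\<^sup>\<star>) (h\<^sup>\<star>) (p\<^sup>\<star>))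
    = split (p \<cdot> h) f \<parallel> (split p h \<sslash> hunit A (f\<^sup>\<star>))"
proof -
  note [simp] = fh hp hcomp_assoc
  note j = globular_join[unfolded globular_def]
  note s = globular_split[unfolded globular_def]
  note [simp] = cellD[OF j] cellD[OF s]
  have [simp]: "ctop A (join (p \<cdot> h) f) = hone A (hcod A p)" "cleft A (join (p \<cdot> h) f) = f\<^sup>\<star> \<bullet> (p \<cdot> h)\<^sup>\<star>"
    "cright A (join (p \<cdot> h) f) = (p \<cdot> (h \<cdot> f))\<^sup>\<star>" "cbot A (join (p \<cdot> h) f) = hone A (hdom A f)"
    "join (p \<cdot> h) f \<in> Cells A"
    using cellD[OF j[of f "p \<cdot> h"]] by simp_all
  have [simp]: "ctop A (split (p \<cdot> h) f) = hone A (hcod A p)" "cright A (split (p \<cdot> h) f) = f\<^sup>\<star> \<bullet> (p \<cdot> h)\<^sup>\<star>"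
    "cleft A (split (p \<cdot> h) f) = (p \<cdot> (h \<cdot> f))\<^sup>\<star>" "cbot A (split (p \<cdot> h) f) = hone A (hdom A f)"
    "split (p \<cdot> h) f \<in> Cells A"
    using cellD[OF s[of f "p \<cdot> h"]] by simp_all
  let ?a = "asc A (f\<^sup>\<star>) (h\<^sup>\<star>) (p\<^sup>\<star>)" and ?a' = "asc' A (f\<^sup>\<star>) (h\<^sup>\<star>) (p\<^sup>\<star>)"
  let ?J1 = "(hunit A (p\<^sup>\<star>) \<sslash> join h f) \<parallel> join p (h \<cdot> f)"
  let ?S1 = "split p (h \<cdot> f) \<parallel> (hunit A (p\<^sup>\<star>) \<sslash> split h f)"
  let ?J2 = "(join p h \<sslash> hunit A (f\<^sup>\<star>)) \<parallel> join (p \<cdot> h) f"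
  let ?S2 = "split (p \<cdot> h) f \<parallel> (split p h \<sslash> hunit A (f\<^sup>\<star>))"
  have "?J1 \<parallel> ?S1 = (hunit A (p\<^sup>\<star>) \<sslash> join h f)
      \<parallel> ((join p (h \<cdot> f) \<parallel> split p (h \<cdot> f)) \<parallel> (hunit A (p\<^sup>\<star>) \<sslash> split h f))"
    by simp
  also have "\<dots> = hunit A (p\<^sup>\<star>) \<sslash> (join h f \<parallel> split h f)"
    by (subst join_hpaste_split) simp_all
  also have "\<dots> = hunit A (f\<^sup>\<star> \<bullet> h\<^sup>\<star> \<bullet> p\<^sup>\<star>)"
    by (subst join_hpaste_split) simp_all
  finally have 1: "?J1 \<parallel> ?S1 = hunit A (f\<^sup>\<star> \<bullet> h\<^sup>\<star> \<bullet> p\<^sup>\<star>)" .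
  have "?S2 \<parallel> ?J2 = split (p \<cdot> h) f \<parallel> (((split p h \<parallel> join p h) \<sslash> hunit A (f\<^sup>\<star>)) \<parallel> join (p \<cdot> h) f)"
    by simp
  also have "\<dots> = hunit A ((p \<cdot> (h \<cdot> f))\<^sup>\<star>)"
    using split_hpaste_join[of f "p \<cdot> h"] by (subst split_hpaste_join) simp_all
  finally have 2: "?S2 \<parallel> ?J2 = hunit A ((p \<cdot> (h \<cdot> f))\<^sup>\<star>)" .
  have "?S1 \<parallel> ?a = ?S2 \<parallel> ?J2 \<parallel> (?S1 \<parallel> ?a)"
    unfolding 2 by simp
  also have "\<dots> = ?S2 \<parallel> (?a' \<parallel> ((?a \<parallel> ?J2) \<parallel> (?S1 \<parallel> ?a)))" by simp
  also have "?a \<parallel> ?J2 = ?J1" by (rule join_assoc) (use assms in simp_all)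
  also have "?J1 \<parallel> (?S1 \<parallel> ?a) = (?J1 \<parallel> ?S1) \<parallel> ?a" by simp
  also have "?S2 \<parallel> (?a' \<parallel> ((?J1 \<parallel> ?S1) \<parallel> ?a)) = ?S2"
    unfolding 1 by simp
  finally show ?thesis by simp
qed

end

section \<open>Coretrocells\<close>

context with_conjoints
begin

lemma coretrocellD:
  assumes "coretrocell f v w g \<alpha>"
  shows "f \<in> Hor A" "g \<in> Hor A" "vert v (hdom A f) (hdom A g)" "vert w (hcod A f) (hcod A g)"
    "vert (f\<^sup>\<star>) (hcod A f) (hdom A f)" "vert (g\<^sup>\<star>) (hcod A g) (hdom A g)"
    "globular A (g\<^sup>\<star> \<bullet> w) (v \<bullet> f\<^sup>\<star>) \<alpha>"
  using assms by (auto simp: coretrocell_def vert_def)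

lemma coretrocell_boundary:
  assumes "coretrocell f v w g \<alpha>"
  shows "\<alpha> \<in> Cells A" "ctop A \<alpha> = hone A (hcod A f)" "cleft A \<alpha> = g\<^sup>\<star> \<bullet> w" "cright A \<alpha> = v \<bullet> f\<^sup>\<star>"
    "cbot A \<alpha> = hone A (hdom A g)"
  using assms by (auto simp: coretrocell_def globular_def cell_def)

text \<open>
  Composition of coretrocells is pasting of squares, conjugated by the comparison of the conjoint of a
  composite with the composite of the conjoints.
\<close>

lemma coretro_comp_square_comp:
  assumes a: "coretrocell f v w g \<alpha>" and b: "coretrocell h w x k \<beta>"
  shows "coretro_comp f v w g \<alpha> h x k \<beta>
    = (hunit A x \<sslash> split k g) \<parallel> square_comp (g\<^sup>\<star>) (k\<^sup>\<star>) x \<beta> w v (f\<^sup>\<star>) (h\<^sup>\<star>) \<alpha> \<parallel> (join h f \<sslash> hunit A v)"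
    and "coretrocell (h \<cdot> f) v x (k \<cdot> g) (coretro_comp f v w g \<alpha> h x k \<beta>)"
proof -
  note A = coretrocellD[OF a] and B = coretrocellD[OF b]
  note [simp] = A(1,2) B(1,2) vertD[OF A(3)] vertD[OF B(3)] vertD[OF B(4)]
    coretrocell_boundary[OF a] coretrocell_boundary[OF b]
  have m: "hcod A f = hdom A h" "hcod A g = hdom A k"
    using vertD[OF A(4)] by simp_all
  note [simp] = m
  note [simp] = cellD[OF globular_join[unfolded globular_def, OF A(1) B(1) m(1)]]
    cellD[OF globular_split[unfolded globular_def, OF A(2) B(2) m(2)]]
  show e: "coretro_comp f v w g \<alpha> h x k \<beta>
    = (hunit A x \<sslash> split k g) \<parallel> square_comp (g\<^sup>\<star>) (k\<^sup>\<star>) x \<beta> w v (f\<^sup>\<star>) (h\<^sup>\<star>) \<alpha> \<parallel> (join h f \<sslash> hunit A v)"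
    by (simp add: coretro_comp_def square_comp_def slide_def)
  have "globular A (g\<^sup>\<star> \<bullet> k\<^sup>\<star> \<bullet> x) (v \<bullet> (f\<^sup>\<star> \<bullet> h\<^sup>\<star>)) (square_comp (g\<^sup>\<star>) (k\<^sup>\<star>) x \<beta> w v (f\<^sup>\<star>) (h\<^sup>\<star>) \<alpha>)"
    using square_comp_globular[OF B(4) B(3) A(3) _ B(6) _ B(5,7) A(7)] A(5,6) by simp
  note [simp] = cellD[OF this[unfolded globular_def]]
  show "coretrocell (h \<cdot> f) v x (k \<cdot> g) (coretro_comp f v w g \<alpha> h x k \<beta>)"
    by (simp add: e coretrocell_def globular_def cell_def)
qed

text \<open>
  The identity coretrocell is an identity square conjugated by binding cells, the form to which the
  whiskering laws for \<open>square_comp\<close> apply.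
\<close>

lemma coretrocell_id:
  assumes v: "vert v a c"
  shows "coretrocell (hone A a) v v (hone A c) (coretro_id v)"
    and "coretro_id v = (hunit A v \<sslash> \<beta>\<beta> (hone A c)) \<parallel> hunit A v \<parallel> (\<alpha>\<alpha> (hone A a) \<sslash> hunit A v)"
  using vertD[OF v] by (simp_all add: coretrocell_def coretro_id_def globular_def cell_def)

lemma globular_binding_hone:
  assumes "a \<in> Obj A"
  shows "globular A (vid A a) (vid A a) (\<alpha>\<alpha> (hone A a))" "globular A (vid A a) (vid A a) (\<beta>\<beta> (hone A a))"
  using assms by (simp_all add: globular_def cell_def)

lemma split_hone:
  assumes k [simp]: "k \<in> Hor A"
  shows "hdom A k = a \<Longrightarrow> split k (hone A a) \<parallel> (hunit A (k\<^sup>\<star>) \<sslash> \<beta>\<beta> (hone A a)) = hunit A (k\<^sup>\<star>)"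
    and "hcod A k = a \<Longrightarrow> split (hone A a) k \<parallel> (\<beta>\<beta> (hone A a) \<sslash> hunit A (k\<^sup>\<star>)) = hunit A (k\<^sup>\<star>)"
  using split_hpaste_join[of "hone A (hdom A k)" k] split_hpaste_join[of k "hone A (hcod A k)"]
  by (auto simp: join_hone_left join_hone_right)

lemma \<alpha>\<alpha>_hone_join:
  assumes h [simp]: "h \<in> Hor A"
  shows "hdom A h = a \<Longrightarrow> (hunit A (h\<^sup>\<star>) \<sslash> \<alpha>\<alpha> (hone A a)) \<parallel> join h (hone A a) = hunit A (h\<^sup>\<star>)"
    and "hcod A h = b \<Longrightarrow> (\<alpha>\<alpha> (hone A b) \<sslash> hunit A (h\<^sup>\<star>)) \<parallel> join (hone A b) h = hunit A (h\<^sup>\<star>)"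
proof -
  let ?a = "hdom A h" and ?b = "hcod A h"
  have "(hunit A (h\<^sup>\<star>) \<sslash> \<alpha>\<alpha> (hone A ?a)) \<parallel> join h (hone A ?a) = hunit A (h\<^sup>\<star>)"
    using interchange[of "hunit A (h\<^sup>\<star>)" "hunit A (h\<^sup>\<star>)" "\<alpha>\<alpha> (hone A ?a)" "\<beta>\<beta> (hone A ?a)", symmetric]
    by (simp add: join_hone_right)
  then show "hdom A h = a \<Longrightarrow> (hunit A (h\<^sup>\<star>) \<sslash> \<alpha>\<alpha> (hone A a)) \<parallel> join h (hone A a) = hunit A (h\<^sup>\<star>)"
    by auto
  have "(\<alpha>\<alpha> (hone A ?b) \<sslash> hunit A (h\<^sup>\<star>)) \<parallel> join (hone A ?b) h = hunit A (h\<^sup>\<star>)"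
    using interchange[of "\<alpha>\<alpha> (hone A ?b)" "\<beta>\<beta> (hone A ?b)" "hunit A (h\<^sup>\<star>)" "hunit A (h\<^sup>\<star>)", symmetric]
    by (simp add: join_hone_left)
  then show "hcod A h = b \<Longrightarrow> (\<alpha>\<alpha> (hone A b) \<sslash> hunit A (h\<^sup>\<star>)) \<parallel> join (hone A b) h = hunit A (h\<^sup>\<star>)"
    by auto
qed

text \<open>
  The binding cells of the identity coretrocell are moved to the outside of the pasting, where each
  cancels against the \<open>split\<close> or \<open>join\<close> of a composite with an identity.
\<close>

lemma coretro_comp_id_left:
  assumes b: "coretrocell h v x k \<beta>"
  shows "coretro_comp (hone A (vdom A v)) v v (hone A (vcod A v)) (coretro_id v) h x k \<beta> = \<beta>"
proof -
  note B = coretrocellD[OF b]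
  note [simp] = B(1,2) vertD[OF B(3)] vertD[OF B(4)] coretrocell_boundary[OF b]
  let ?a = "hdom A h" and ?c = "hdom A k"
  have o: "?a \<in> Obj A" "?c \<in> Obj A" by simp_all
  have gv: "globular A (vid A ?c \<bullet> v) (v \<bullet> vid A ?a) (hunit A v)"
    by (simp add: globular_def cell_def)
  have va: "vert (vid A ?a) ?a ?a" "vert (vid A ?c) ?c ?c" using o by (simp_all add: vert_def)
  have i: "coretrocell (hone A ?a) v v (hone A ?c) (coretro_id v)" by (rule coretrocell_id(1)[OF B(3)])
  note [simp] = cellD[OF globular_join[unfolded globular_def, of "hone A ?a" h]]
    cellD[OF globular_split[unfolded globular_def, of "hone A ?c" k]]
  have "square_comp (vid A ?c) (k\<^sup>\<star>) x \<beta> v v (vid A ?a) (h\<^sup>\<star>) (coretro_id v)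
    = (hunit A x \<sslash> (hunit A (k\<^sup>\<star>) \<sslash> \<beta>\<beta> (hone A ?c))) \<parallel> \<beta> \<parallel> ((hunit A (h\<^sup>\<star>) \<sslash> \<alpha>\<alpha> (hone A ?a)) \<sslash> hunit A v)"
    unfolding coretrocell_id(2)[OF B(3)]
    by (subst square_comp_whisker_left[OF B(4,3,3) va(2) B(6) va(1) B(5) va(2,1) B(7) gv
          globular_binding_hone(2)[OF o(2)] globular_binding_hone(1)[OF o(1)]],
       subst square_comp_unit_left[OF B(4,3,6,5,7)], rule refl)
  then have "coretro_comp (hone A ?a) v v (hone A ?c) (coretro_id v) h x k \<beta>
    = (hunit A x \<sslash> split k (hone A ?c)) \<parallel> ((hunit A x \<sslash> (hunit A (k\<^sup>\<star>) \<sslash> \<beta>\<beta> (hone A ?c))) \<parallel> \<beta>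
      \<parallel> ((hunit A (h\<^sup>\<star>) \<sslash> \<alpha>\<alpha> (hone A ?a)) \<sslash> hunit A v)) \<parallel> (join h (hone A ?a) \<sslash> hunit A v)"
    using coretro_comp_square_comp(1)[OF i b] by simp
  also have "\<dots> = (hunit A x \<sslash> (split k (hone A ?c) \<parallel> (hunit A (k\<^sup>\<star>) \<sslash> \<beta>\<beta> (hone A ?c)))) \<parallel> (\<beta>
      \<parallel> (((hunit A (h\<^sup>\<star>) \<sslash> \<alpha>\<alpha> (hone A ?a)) \<parallel> join h (hone A ?a)) \<sslash> hunit A v))"
    by simp
  also have "\<dots> = \<beta>"
    unfolding split_hone(1)[OF B(2) refl] \<alpha>\<alpha>_hone_join(1)[OF B(1) refl] by simp
  finally show ?thesis by simp
qed

lemma coretro_comp_id_right: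
  assumes b: "coretrocell f v w g \<alpha>"
  shows "coretro_comp f v w g \<alpha> (hone A (vdom A w)) w (hone A (vcod A w)) (coretro_id w) = \<alpha>"
proof -
  note B = coretrocellD[OF b]
  note [simp] = B(1,2) vertD[OF B(3)] vertD[OF B(4)] coretrocell_boundary[OF b]
  let ?a = "hcod A f" and ?c = "hcod A g"
  have o: "?a \<in> Obj A" "?c \<in> Obj A" by simp_all
  have gv: "globular A (vid A ?c \<bullet> w) (w \<bullet> vid A ?a) (hunit A w)"
    by (simp add: globular_def cell_def)
  have va: "vert (vid A ?a) ?a ?a" "vert (vid A ?c) ?c ?c" using o by (simp_all add: vert_def)
  have i: "coretrocell (hone A ?a) w w (hone A ?c) (coretro_id w)" by (rule coretrocell_id(1)[OF B(4)])
  note [simp] = cellD[OF globular_join[unfolded globular_def, of f "hone A ?a"]]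
    cellD[OF globular_split[unfolded globular_def, of g "hone A ?c"]]
  have "square_comp (g\<^sup>\<star>) (vid A ?c) w (coretro_id w) w v (f\<^sup>\<star>) (vid A ?a) \<alpha>
    = (hunit A w \<sslash> (\<beta>\<beta> (hone A ?c) \<sslash> hunit A (g\<^sup>\<star>))) \<parallel> \<alpha> \<parallel> ((\<alpha>\<alpha> (hone A ?a) \<sslash> hunit A (f\<^sup>\<star>)) \<sslash> hunit A v)"
    unfolding coretrocell_id(2)[OF B(4)]
    by (subst square_comp_whisker_right[OF B(4,4,3,6) va(2) B(5) va(1,2,1) gv B(7)
          globular_binding_hone(2)[OF o(2)] globular_binding_hone(1)[OF o(1)]],
       subst square_comp_unit_right[OF B(4,3,6,5,7)], rule refl)
  then have "coretro_comp f v w g \<alpha> (hone A ?a) w (hone A ?c) (coretro_id w)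
    = (hunit A w \<sslash> split (hone A ?c) g) \<parallel> ((hunit A w \<sslash> (\<beta>\<beta> (hone A ?c) \<sslash> hunit A (g\<^sup>\<star>))) \<parallel> \<alpha>
      \<parallel> ((\<alpha>\<alpha> (hone A ?a) \<sslash> hunit A (f\<^sup>\<star>)) \<sslash> hunit A v)) \<parallel> (join (hone A ?a) f \<sslash> hunit A v)"
    using coretro_comp_square_comp(1)[OF b i] by simp
  also have "\<dots> = (hunit A w \<sslash> (split (hone A ?c) g \<parallel> (\<beta>\<beta> (hone A ?c) \<sslash> hunit A (g\<^sup>\<star>)))) \<parallel> (\<alpha>
      \<parallel> (((\<alpha>\<alpha> (hone A ?a) \<sslash> hunit A (f\<^sup>\<star>)) \<parallel> join (hone A ?a) f) \<sslash> hunit A v))"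
    by simp
  also have "\<dots> = \<alpha>"
    unfolding split_hone(2)[OF B(2) refl] \<alpha>\<alpha>_hone_join(2)[OF B(1) refl] by simp
  finally show ?thesis by simp
qed

text \<open>
  In both bracketings the inner comparison cells are whiskered outwards. What remains inside is
  associativity of \<open>square_comp\<close>, whose two associativity cells are absorbed by the coherence of \<open>split\<close> and
  \<open>join\<close>.
\<close>

lemma coretro_comp_assoc:
  assumes a: "coretrocell f v w g \<alpha>" and b: "coretrocell h w x k \<beta>" and d: "coretrocell p x y q \<delta>"
  shows "coretro_comp f v w g \<alpha> (p \<cdot> h) y (q \<cdot> k) (coretro_comp h w x k \<beta> p y q \<delta>)
    = coretro_comp (h \<cdot> f) v x (k \<cdot> g) (coretro_comp f v w g \<alpha> h x k \<beta>) p y q \<delta>"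
proof -
  note A = coretrocellD[OF a] and B = coretrocellD[OF b] and D = coretrocellD[OF d]
  have m: "hcod A f = hdom A h" "hcod A g = hdom A k" "hcod A h = hdom A p" "hcod A k = hdom A q"
    using vertD[OF A(4)] vertD[OF B(4)] vertD[OF B(3)] vertD[OF D(3)] by simp_all
  note ab = coretro_comp_square_comp[OF a b] and bd = coretro_comp_square_comp[OF b d]
  note [simp] = A(1,2) B(1,2) D(1,2) vertD[OF A(3)] vertD[OF B(3)] vertD[OF D(3)] vertD[OF D(4)]
    coretrocell_boundary[OF a] coretrocell_boundary[OF b] coretrocell_boundary[OF d] m
  note ve = A(3) B(3) D(3,4)
  have st: "vert (f\<^sup>\<star>) (hdom A h) (hdom A f)" "vert (h\<^sup>\<star>) (hdom A p) (hdom A h)"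
    "vert (p\<^sup>\<star>) (hcod A p) (hdom A p)"
    "vert (g\<^sup>\<star>) (hdom A k) (hdom A g)" "vert (k\<^sup>\<star>) (hdom A q) (hdom A k)"
    "vert (q\<^sup>\<star>) (hcod A q) (hdom A q)" "vert ((h \<cdot> f)\<^sup>\<star>) (hdom A p) (hdom A f)"
    "vert ((k \<cdot> g)\<^sup>\<star>) (hdom A q) (hdom A g)" "vert ((p \<cdot> h)\<^sup>\<star>) (hcod A p) (hdom A h)"
    "vert ((q \<cdot> k)\<^sup>\<star>) (hcod A q) (hdom A k)"
    "vert (f\<^sup>\<star> \<bullet> h\<^sup>\<star>) (hdom A p) (hdom A f)" "vert (g\<^sup>\<star> \<bullet> k\<^sup>\<star>) (hdom A q) (hdom A g)"
    "vert (h\<^sup>\<star> \<bullet> p\<^sup>\<star>) (hcod A p) (hdom A h)" "vert (k\<^sup>\<star> \<bullet> q\<^sup>\<star>) (hcod A q) (hdom A k)"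
    by (simp_all add: vert_def)
  let ?AB = "square_comp (g\<^sup>\<star>) (k\<^sup>\<star>) x \<beta> w v (f\<^sup>\<star>) (h\<^sup>\<star>) \<alpha>"
  let ?BD = "square_comp (k\<^sup>\<star>) (q\<^sup>\<star>) y \<delta> x w (h\<^sup>\<star>) (p\<^sup>\<star>) \<beta>"
  have gAB: "globular A (g\<^sup>\<star> \<bullet> k\<^sup>\<star> \<bullet> x) (v \<bullet> (f\<^sup>\<star> \<bullet> h\<^sup>\<star>)) ?AB"
    by (rule square_comp_globular[OF ve(3,2,1) st(4,5,1,2) B(7) A(7)])
  have gBD: "globular A (k\<^sup>\<star> \<bullet> q\<^sup>\<star> \<bullet> y) (w \<bullet> (h\<^sup>\<star> \<bullet> p\<^sup>\<star>)) ?BD"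
    by (rule square_comp_globular[OF ve(4,3,2) st(5,6,2,3) D(7) B(7)])
  let ?L = "square_comp (g\<^sup>\<star>) (k\<^sup>\<star> \<bullet> q\<^sup>\<star>) y ?BD w v (f\<^sup>\<star>) (h\<^sup>\<star> \<bullet> p\<^sup>\<star>) \<alpha>"
  let ?R = "square_comp (g\<^sup>\<star> \<bullet> k\<^sup>\<star>) (q\<^sup>\<star>) y \<delta> x v (f\<^sup>\<star> \<bullet> h\<^sup>\<star>) (p\<^sup>\<star>) ?AB"
  have gL: "globular A (g\<^sup>\<star> \<bullet> (k\<^sup>\<star> \<bullet> q\<^sup>\<star>) \<bullet> y) (v \<bullet> (f\<^sup>\<star> \<bullet> (h\<^sup>\<star> \<bullet> p\<^sup>\<star>))) ?L"
    by (rule square_comp_globular[OF ve(4,2,1) st(4,14,1,13) gBD A(7)])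
  have gR: "globular A (g\<^sup>\<star> \<bullet> k\<^sup>\<star> \<bullet> q\<^sup>\<star> \<bullet> y) (v \<bullet> (f\<^sup>\<star> \<bullet> h\<^sup>\<star> \<bullet> p\<^sup>\<star>)) ?R"
    by (rule square_comp_globular[OF ve(4,3,1) st(12,6,11,3) D(7) gAB])
  note [simp] = cellD[OF gL[unfolded globular_def]] cellD[OF gR[unfolded globular_def]]
  note js = globular_join[unfolded globular_def] globular_split[unfolded globular_def]
  note [simp] = cellD[OF js(1)] cellD[OF js(2)]
  have jss [simp]: "cell A (hone A (hcod A p)) (f\<^sup>\<star> \<bullet> (p \<cdot> h)\<^sup>\<star>) ((p \<cdot> (h \<cdot> f))\<^sup>\<star>) (hone A (hdom A f)) (join (p \<cdot> h) f)"
    "cell A (hone A (hcod A q)) ((q \<cdot> (k \<cdot> g))\<^sup>\<star>) (g\<^sup>\<star> \<bullet> (q \<cdot> k)\<^sup>\<star>) (hone A (hdom A g)) (split (q \<cdot> k) g)"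
    using js(1)[of f "p \<cdot> h"] js(2)[of g "q \<cdot> k"] by (simp_all add: hcomp_assoc)
  note [simp] = cellD[OF jss(1)] cellD[OF jss(2)]
  have "coretro_comp f v w g \<alpha> (p \<cdot> h) y (q \<cdot> k) (coretro_comp h w x k \<beta> p y q \<delta>)
    = (hunit A y \<sslash> split (q \<cdot> k) g)
      \<parallel> ((hunit A y \<sslash> (split q k \<sslash> hunit A (g\<^sup>\<star>))) \<parallel> ?L \<parallel> ((join p h \<sslash> hunit A (f\<^sup>\<star>)) \<sslash> hunit A v))
      \<parallel> (join (p \<cdot> h) f \<sslash> hunit A v)"
    unfolding coretro_comp_square_comp(1)[OF a bd(2)] unfolding bd(1)
    by (subst square_comp_whisker_right[OF ve(4,2,1) st(4,14,1,13,10,9) gBD A(7)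
      globular_split[OF B(2) D(2) m(4)] globular_join[OF B(1) D(1) m(3)]]) (rule refl)
  also have "\<dots> = (hunit A y \<sslash> (split (q \<cdot> k) g \<parallel> (split q k \<sslash> hunit A (g\<^sup>\<star>)))) \<parallel> (?L
      \<parallel> (((join p h \<sslash> hunit A (f\<^sup>\<star>)) \<parallel> join (p \<cdot> h) f) \<sslash> hunit A v))"
    by simp
  also have "split (q \<cdot> k) g \<parallel> (split q k \<sslash> hunit A (g\<^sup>\<star>))
     = split q (k \<cdot> g) \<parallel> ((hunit A (q\<^sup>\<star>) \<sslash> split k g) \<parallel> asc A (g\<^sup>\<star>) (k\<^sup>\<star>) (q\<^sup>\<star>))"
    by (rule split_assoc[symmetric]) simp_all
  also have "(hunit A y \<sslash> \<dots>) \<parallel> (?L \<parallel> (((join p h \<sslash> hunit A (f\<^sup>\<star>)) \<parallel> join (p \<cdot> h) f) \<sslash> hunit A v))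
     = (hunit A y \<sslash> (split q (k \<cdot> g) \<parallel> (hunit A (q\<^sup>\<star>) \<sslash> split k g)))
       \<parallel> (((hunit A y \<sslash> asc A (g\<^sup>\<star>) (k\<^sup>\<star>) (q\<^sup>\<star>)) \<parallel> ?L)
       \<parallel> (((join p h \<sslash> hunit A (f\<^sup>\<star>)) \<parallel> join (p \<cdot> h) f) \<sslash> hunit A v))"
    by simp
  also have "(hunit A y \<sslash> asc A (g\<^sup>\<star>) (k\<^sup>\<star>) (q\<^sup>\<star>)) \<parallel> ?L = ?R \<parallel> (asc A (f\<^sup>\<star>) (h\<^sup>\<star>) (p\<^sup>\<star>) \<sslash> hunit A v)"
    by (rule square_comp_assoc[OF ve(4,3,2,1) st(4,5,6,1,2,3) D(7) B(7) A(7)])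
  also have "(hunit A y \<sslash> (split q (k \<cdot> g) \<parallel> (hunit A (q\<^sup>\<star>) \<sslash> split k g)))
       \<parallel> ((?R \<parallel> (asc A (f\<^sup>\<star>) (h\<^sup>\<star>) (p\<^sup>\<star>) \<sslash> hunit A v))
       \<parallel> (((join p h \<sslash> hunit A (f\<^sup>\<star>)) \<parallel> join (p \<cdot> h) f) \<sslash> hunit A v))
    = (hunit A y \<sslash> (split q (k \<cdot> g) \<parallel> (hunit A (q\<^sup>\<star>) \<sslash> split k g)))
       \<parallel> (?R \<parallel> ((asc A (f\<^sup>\<star>) (h\<^sup>\<star>) (p\<^sup>\<star>) \<parallel> ((join p h \<sslash> hunit A (f\<^sup>\<star>)) \<parallel> join (p \<cdot> h) f)) \<sslash> hunit A v))"
    by simp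
  also have "asc A (f\<^sup>\<star>) (h\<^sup>\<star>) (p\<^sup>\<star>) \<parallel> ((join p h \<sslash> hunit A (f\<^sup>\<star>)) \<parallel> join (p \<cdot> h) f)
     = (hunit A (p\<^sup>\<star>) \<sslash> join h f) \<parallel> join p (h \<cdot> f)"
    by (rule join_assoc) simp_all
  also have "(hunit A y \<sslash> (split q (k \<cdot> g) \<parallel> (hunit A (q\<^sup>\<star>) \<sslash> split k g)))
       \<parallel> (?R \<parallel> (((hunit A (p\<^sup>\<star>) \<sslash> join h f) \<parallel> join p (h \<cdot> f)) \<sslash> hunit A v))
     = (hunit A y \<sslash> split q (k \<cdot> g))
      \<parallel> ((hunit A y \<sslash> (hunit A (q\<^sup>\<star>) \<sslash> split k g)) \<parallel> ?R \<parallel> ((hunit A (p\<^sup>\<star>) \<sslash> join h f) \<sslash> hunit A v))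
      \<parallel> (join p (h \<cdot> f) \<sslash> hunit A v)"
    by simp
  also have "\<dots> = coretro_comp (h \<cdot> f) v x (k \<cdot> g) (coretro_comp f v w g \<alpha> h x k \<beta>) p y q \<delta>"
    unfolding coretro_comp_square_comp(1)[OF ab(2) d] unfolding ab(1)
    by (subst square_comp_whisker_left[OF ve(4,3,1) st(12,6,11,3,8,7) D(7) gAB
      globular_split[OF A(2) B(2) m(2)] globular_join[OF A(1) B(1) m(1)]]) (rule refl)
  finally show ?thesis .
qed

end

section \<open>The category of spans\<close>

context with_conjoints
begin

lemma TS_ArE:
  assumes "m \<in> Ar TS"
  obtains x z x' z' where "src m = (x, z)" "tgt m = (x', z')"
    "x \<in> Ver A" "z \<in> Ver A" "vdom A x = vdom A z" "x' \<in> Ver A" "z' \<in> Ver A" "vdom A x' = vdom A z'"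
    "coretrocell (ar_a m) x x' (ar_b m) (co m)" "cell A (ar_a m) z z' (ar_c m) (ce m)"
  using assms by (fastforce simp: TS_def)

lemma TS_ArI:
  assumes "src m = (x, z)" "tgt m = (x', z')"
    "x \<in> Ver A" "z \<in> Ver A" "vdom A x = vdom A z" "x' \<in> Ver A" "z' \<in> Ver A" "vdom A x' = vdom A z'"
    "coretrocell (ar_a m) x x' (ar_b m) (co m)" "cell A (ar_a m) z z' (ar_c m) (ce m)"
  shows "m \<in> Ar TS"
proof -
  have "m = \<lparr>src = (x, z), tgt = (x', z'), ar_a = ar_a m, ar_b = ar_b m, ar_c = ar_c m, co = co m, ce = ce m\<rparr>"
    using assms(1,2) by simp
  then show ?thesis using assms(3-) unfolding TS_def by simp blast
qed

lemma TS_simps: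
  "Ob TS = {(x, z). x \<in> Ver A \<and> z \<in> Ver A \<and> vdom A x = vdom A z}"
  "Dom TS m = src m" "Cod TS m = tgt m"
  "Id TS (x, z) = \<lparr>src = (x, z), tgt = (x, z),
       ar_a = hone A (vdom A x), ar_b = hone A (vcod A x), ar_c = hone A (vcod A z),
       co = coretro_id x, ce = hunit A z\<rparr>"
  "Comp TS n m = \<lparr>src = src m, tgt = tgt n,
       ar_a = ar_a n \<cdot> ar_a m, ar_b = ar_b n \<cdot> ar_b m, ar_c = ar_c n \<cdot> ar_c m,
       co = coretro_comp (ar_a m) (fst (src m)) (fst (tgt m)) (ar_b m) (co m)
              (ar_a n) (fst (tgt n)) (ar_b n) (co n),
       ce = ce m \<parallel> ce n\<rparr>"
  by (simp_all add: TS_def)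

lemma TS_category: "category TS"
proof
  fix m assume "m \<in> Ar TS"
  then show "Dom TS m \<in> Ob TS" "Cod TS m \<in> Ob TS"
    by (auto elim!: TS_ArE simp: TS_simps)
next
  fix X assume X: "X \<in> Ob TS"
  then obtain x z where [simp]: "X = (x, z)" "x \<in> Ver A" "z \<in> Ver A" and d: "vdom A x = vdom A z"
    by (auto simp: TS_simps)
  have "coretrocell (hone A (vdom A x)) x x (hone A (vcod A x)) (coretro_id x)"
    by (rule coretrocell_id) (simp add: vert_def)
  then show "Id TS X \<in> Ar TS"
    using d by (intro TS_ArI[of _ x z x z]) (simp_all add: TS_simps cell_def)
  show "Dom TS (Id TS X) = X" "Cod TS (Id TS X) = X" by (simp_all add: TS_simps)
next
  fix m n assume m: "m \<in> Ar TS" and n: "n \<in> Ar TS" and mn: "Cod TS m = Dom TS n"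
  show "Comp TS n m \<in> Ar TS"
    using m n
  proof (elim TS_ArE)
    fix x z x' z' y w y' w'
    assume s: "src m = (x, z)" "tgt m = (x', z')" "src n = (y, w)" "tgt n = (y', w')"
      and v: "x \<in> Ver A" "z \<in> Ver A" "vdom A x = vdom A z" "y' \<in> Ver A" "w' \<in> Ver A" "vdom A y' = vdom A w'"
      and cm: "coretrocell (ar_a m) x x' (ar_b m) (co m)" and gm: "cell A (ar_a m) z z' (ar_c m) (ce m)"
      and cn: "coretrocell (ar_a n) y y' (ar_b n) (co n)" and gn: "cell A (ar_a n) w w' (ar_c n) (ce n)"
    from s mn have [simp]: "y = x'" "w = z'" by (auto simp: TS_simps)
    note [simp] = cellD[OF gm] cellD[OF gn]
    show "Comp TS n m \<in> Ar TS"
      using v coretro_comp_square_comp(2)[OF cm cn[simplified]] s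
      by (intro TS_ArI[of _ x z y' w']) (simp_all add: TS_simps cell_def)
  qed
  show "Dom TS (Comp TS n m) = Dom TS m" "Cod TS (Comp TS n m) = Cod TS n"
    by (simp_all add: TS_simps)
next
  fix m assume m: "m \<in> Ar TS"
  then obtain x z x' z' where s: "src m = (x, z)" "tgt m = (x', z')"
    and v [simp]: "x \<in> Ver A" "z \<in> Ver A" "x' \<in> Ver A" "z' \<in> Ver A" and e: "vdom A x = vdom A z" "vdom A x' = vdom A z'"
    and c: "coretrocell (ar_a m) x x' (ar_b m) (co m)" and g: "cell A (ar_a m) z z' (ar_c m) (ce m)"
    by (rule TS_ArE)
  note [simp] = cellD[OF g] coretrocellD(1,2)[OF c]
  have h: "hdom A (ar_a m) = vdom A x" "hcod A (ar_a m) = vdom A x'" "hdom A (ar_b m) = vcod A x"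
    "hcod A (ar_b m) = vcod A x'" "ar_c m \<in> Hor A" "hdom A (ar_c m) = vcod A z" "hcod A (ar_c m) = vcod A z'"
    using c g cbot_in[of "ce m"] hdom_cbot[of "ce m"] hcod_cbot[of "ce m"]
    by (simp_all add: coretrocell_def)
  show "Comp TS m (Id TS (Dom TS m)) = m"
    using coretro_comp_id_left[OF c] s h by (intro ts_arrow.equality) (simp_all add: TS_simps)
  show "Comp TS (Id TS (Cod TS m)) m = m"
    using coretro_comp_id_right[OF c] s h by (intro ts_arrow.equality) (simp_all add: TS_simps)
next
  fix l m n assume l: "l \<in> Ar TS" and m: "m \<in> Ar TS" and n: "n \<in> Ar TS"
    and lm: "Cod TS l = Dom TS m" and mn: "Cod TS m = Dom TS n"
  have E: "\<exists>x z x' z'. src k = (x, z) \<and> tgt k = (x', z') \<and> coretrocell (ar_a k) x x' (ar_b k) (co k)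
      \<and> cell A (ar_a k) z z' (ar_c k) (ce k)" if "k \<in> Ar TS" for k
    using that by (elim TS_ArE) blast
  obtain x z x' z' y w y' w' where s: "src l = (x, z)" "tgt l = (x', z')" "src n = (y, w)" "tgt n = (y', w')"
    and cl: "coretrocell (ar_a l) x x' (ar_b l) (co l)" and gl: "cell A (ar_a l) z z' (ar_c l) (ce l)"
    and cn: "coretrocell (ar_a n) y y' (ar_b n) (co n)" and gn: "cell A (ar_a n) w w' (ar_c n) (ce n)"
    using E[OF l] E[OF n] by blast
  have cm: "coretrocell (ar_a m) x' y (ar_b m) (co m)" and gm: "cell A (ar_a m) z' w (ar_c m) (ce m)"
    using E[OF m] lm mn s by (auto simp: TS_simps)
  have s': "src m = (x', z')" "tgt m = (y, w)" using lm mn s by (auto simp: TS_simps)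
  note [simp] = cellD[OF gl] cellD[OF gm] cellD[OF gn]
  have c: "ar_c l \<in> Hor A" "ar_c m \<in> Hor A" "ar_c n \<in> Hor A"
    "hcod A (ar_c l) = hdom A (ar_c m)" "hcod A (ar_c m) = hdom A (ar_c n)"
    using cbot_in[of "ce l"] cbot_in[of "ce m"] cbot_in[of "ce n"]
      hcod_cbot[of "ce l"] hdom_cbot[of "ce m"] hcod_cbot[of "ce m"] hdom_cbot[of "ce n"] by simp_all
  have ab: "ar_a n \<cdot> ar_a m \<cdot> ar_a l = ar_a n \<cdot> (ar_a m \<cdot> ar_a l)" 
    "ar_b n \<cdot> ar_b m \<cdot> ar_b l = ar_b n \<cdot> (ar_b m \<cdot> ar_b l)"
    "ar_c n \<cdot> ar_c m \<cdot> ar_c l = ar_c n \<cdot> (ar_c m \<cdot> ar_c l)"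
    using cl cm cn c by (auto intro!: hcomp_assoc simp: coretrocell_def)
  show "Comp TS n (Comp TS m l) = Comp TS (Comp TS n m) l"
    using coretro_comp_assoc[OF cl cm cn] s s' by (simp add: TS_simps ab)
qed

end

section \<open>The action of the right hom on morphisms\<close>

context with_conjoints
begin

text \<open>
  Transposing \<open>\<gamma> \<parallel> \<delta>\<close> along a composite arrow is, up to comparison, transposing \<open>\<gamma>\<close> along \<open>f\<close> and \<open>\<delta>\<close> along
  \<open>h\<close>. It is used both for the cells of two morphisms of spans and for the cells they induce.
\<close>

lemma \<beta>\<beta>_hcomp_vpaste:
  assumes f: "f \<in> Hor A" and h: "h \<in> Hor A" and fh: "hcod A f = hdom A h"
    and \<gamma>: "cell A f z z' g \<gamma>" and \<delta>: "cell A h z' z'' k \<delta>"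
  shows "\<beta>\<beta> (h \<cdot> f) \<sslash> (\<gamma> \<parallel> \<delta>)
    = (split h f \<sslash> hunit A z) \<parallel> (asc' A z (f\<^sup>\<star>) (h\<^sup>\<star>)
      \<parallel> ((hunit A (h\<^sup>\<star>) \<sslash> (\<beta>\<beta> f \<sslash> \<gamma>)) \<parallel> (\<beta>\<beta> h \<sslash> \<delta>)))"
    and "(join h f \<sslash> hunit A z) \<parallel> (\<beta>\<beta> (h \<cdot> f) \<sslash> (\<gamma> \<parallel> \<delta>))
    = asc' A z (f\<^sup>\<star>) (h\<^sup>\<star>) \<parallel> ((hunit A (h\<^sup>\<star>) \<sslash> (\<beta>\<beta> f \<sslash> \<gamma>)) \<parallel> (\<beta>\<beta> h \<sslash> \<delta>))"
proof -
  note [simp] = f h fh cellD[OF \<gamma>] cellD[OF \<delta>]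
    cellD[OF globular_join[OF f h fh, unfolded globular_def]]
    cellD[OF globular_split[OF f h fh, unfolded globular_def]]
  have [simp]: "z \<in> Ver A" "z' \<in> Ver A" "z'' \<in> Ver A" "vdom A z = hdom A f" "vdom A z' = hdom A h"
    "vdom A z'' = hcod A h" "g \<in> Hor A" "k \<in> Hor A" "hcod A g = hdom A k" "hdom A g = vcod A z"
    "vcod A z' = hdom A k"
    "vcod A z'' = hcod A k"
    using cleft_in[of \<gamma>] cleft_in[of \<delta>] cright_in[of \<delta>] hdom_ctop[of \<gamma>] hdom_ctop[of \<delta>] hcod_ctop[of \<delta>]
      cbot_in[of \<gamma>] cbot_in[of \<delta>] hcod_cbot[of \<gamma>] hdom_cbot[of \<gamma>] hdom_cbot[of \<delta>] hcod_cbot[of \<delta>]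
    by (simp_all del: cleft_in cright_in hdom_ctop hcod_ctop cbot_in hcod_cbot hdom_cbot)
  let ?B = "\<beta>\<beta> h \<sslash> (\<beta>\<beta> f \<parallel> vunit A h)"
  have "\<beta>\<beta> (h \<cdot> f) \<sslash> (\<gamma> \<parallel> \<delta>) = (split h f \<sslash> hunit A z) \<parallel> (?B \<sslash> (\<gamma> \<parallel> \<delta>))"
    unfolding split_hpaste_\<beta>\<beta>[OF f h fh, symmetric]
    using interchange[of "split h f" ?B "hunit A z" "\<gamma> \<parallel> \<delta>"] by simp
  also have "?B \<sslash> (\<gamma> \<parallel> \<delta>) = asc' A z (f\<^sup>\<star>) (h\<^sup>\<star>) \<parallel> (\<beta>\<beta> h \<sslash> ((\<beta>\<beta> f \<parallel> vunit A h) \<sslash> (\<gamma> \<parallel> \<delta>)))"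
    using asc'_natural[of "\<beta>\<beta> h" "\<beta>\<beta> f \<parallel> vunit A h" "\<gamma> \<parallel> \<delta>"] by simp
  also have "(\<beta>\<beta> f \<parallel> vunit A h) \<sslash> (\<gamma> \<parallel> \<delta>) = (\<beta>\<beta> f \<sslash> \<gamma>) \<parallel> \<delta>"
    using interchange[of "\<beta>\<beta> f" "vunit A h" \<gamma> \<delta>] by simp
  also have "\<beta>\<beta> h \<sslash> ((\<beta>\<beta> f \<sslash> \<gamma>) \<parallel> \<delta>) = (hunit A (h\<^sup>\<star>) \<sslash> (\<beta>\<beta> f \<sslash> \<gamma>)) \<parallel> (\<beta>\<beta> h \<sslash> \<delta>)"
    using interchange[of "hunit A (h\<^sup>\<star>)" "\<beta>\<beta> h" "\<beta>\<beta> f \<sslash> \<gamma>" \<delta>] by simp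
  finally show 1: "\<beta>\<beta> (h \<cdot> f) \<sslash> (\<gamma> \<parallel> \<delta>)
    = (split h f \<sslash> hunit A z) \<parallel> (asc' A z (f\<^sup>\<star>) (h\<^sup>\<star>)
      \<parallel> ((hunit A (h\<^sup>\<star>) \<sslash> (\<beta>\<beta> f \<sslash> \<gamma>)) \<parallel> (\<beta>\<beta> h \<sslash> \<delta>)))" .
  let ?Z = "asc' A z (f\<^sup>\<star>) (h\<^sup>\<star>) \<parallel> ((hunit A (h\<^sup>\<star>) \<sslash> (\<beta>\<beta> f \<sslash> \<gamma>)) \<parallel> (\<beta>\<beta> h \<sslash> \<delta>))"
  have "(join h f \<sslash> hunit A z) \<parallel> (\<beta>\<beta> (h \<cdot> f) \<sslash> (\<gamma> \<parallel> \<delta>))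
    = ((join h f \<parallel> split h f) \<sslash> hunit A z) \<parallel> ?Z"
    unfolding 1 by simp
  also have "\<dots> = ?Z" unfolding join_hpaste_split[OF f h fh] by simp
  finally show "(join h f \<sslash> hunit A z) \<parallel> (\<beta>\<beta> (h \<cdot> f) \<sslash> (\<gamma> \<parallel> \<delta>)) = ?Z" .
qed

text \<open>
  The vertical arrows \<open>r\<close>, \<open>r'\<close>, \<open>r''\<close> stand for the right homs. The cell \<open>\<xi> \<parallel> \<theta>\<close> is split into transposes of
  \<open>\<xi>\<close> and \<open>\<theta>\<close>; the equation for \<open>\<theta>\<close> replaces the latter by a \<open>slide\<close>, past which the transpose of \<open>\<xi>\<close> moves
  until it meets \<open>\<epsilon>'\<close> and the equation for \<open>\<xi>\<close> applies. The two nested slides obtained are the slide of a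
  composite square by \<open>slide_assoc\<close>.
\<close>

lemma hom_action_comp:
  assumes a: "coretrocell f x x' g \<alpha>" and b: "coretrocell h x' x'' k \<beta>"
    and \<gamma>: "cell A f z z' c \<gamma>" and \<delta>: "cell A h z' z'' l \<delta>"
    and r: "vert r (vcod A x) (vcod A z)" and \<epsilon>: "globular A (r \<bullet> x) z \<epsilon>"
    and r': "vert r' (vcod A x') (vcod A z')" and \<epsilon>': "globular A (r' \<bullet> x') z' \<epsilon>'"
    and r'': "vert r'' (vcod A x'') (vcod A z'')" and \<epsilon>'': "globular A (r'' \<bullet> x'') z'' \<epsilon>''"
    and \<xi>: "cell A g r r' c \<xi>" and \<theta>: "cell A k r' r'' l \<theta>"
    and e\<xi>: "(hunit A x' \<sslash> (\<beta>\<beta> g \<sslash> \<xi>)) \<parallel> \<epsilon>' = slide r (g\<^sup>\<star>) x' \<alpha> x (f\<^sup>\<star>) \<epsilon> \<parallel> (\<beta>\<beta> f \<sslash> \<gamma>)"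
    and e\<theta>: "(hunit A x'' \<sslash> (\<beta>\<beta> k \<sslash> \<theta>)) \<parallel> \<epsilon>'' = slide r' (k\<^sup>\<star>) x'' \<beta> x' (h\<^sup>\<star>) \<epsilon>' \<parallel> (\<beta>\<beta> h \<sslash> \<delta>)"
  shows "(hunit A x'' \<sslash> (\<beta>\<beta> (k \<cdot> g) \<sslash> (\<xi> \<parallel> \<theta>))) \<parallel> \<epsilon>''
    = slide r ((k \<cdot> g)\<^sup>\<star>) x'' (coretro_comp f x x' g \<alpha> h x'' k \<beta>) x ((h \<cdot> f)\<^sup>\<star>) \<epsilon>
      \<parallel> (\<beta>\<beta> (h \<cdot> f) \<sslash> (\<gamma> \<parallel> \<delta>))"
proof -
  note A = coretrocellD[OF a] and B = coretrocellD[OF b]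
  have m: "hcod A f = hdom A h" "hcod A g = hdom A k"
    using vertD[OF A(4)] vertD[OF B(3)] by simp_all
  note [simp] = A(1,2) B(1,2) vertD[OF A(3)] vertD[OF B(3)] vertD[OF B(4)] m
    coretrocell_boundary[OF a] coretrocell_boundary[OF b] cellD[OF \<gamma>] cellD[OF \<delta>] cellD[OF \<xi>] cellD[OF \<theta>]
  have z [simp]: "z \<in> Ver A" "z' \<in> Ver A" "z'' \<in> Ver A" "vdom A z = hdom A f" "vdom A z' = hdom A h"
    "vdom A z'' = hcod A h" "c \<in> Hor A" "l \<in> Hor A" "hcod A c = hdom A l" "vcod A z = hdom A c"
    "vcod A z' = hdom A l"
    "vcod A z'' = hcod A l"
    using cleft_in[of \<gamma>] cleft_in[of \<delta>] cright_in[of \<delta>] hdom_ctop[of \<gamma>] hdom_ctop[of \<delta>] hcod_ctop[of \<delta>]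
      cbot_in[of \<gamma>] cbot_in[of \<delta>] hcod_cbot[of \<gamma>] hdom_cbot[of \<gamma>] hdom_cbot[of \<delta>] hcod_cbot[of \<delta>]
    by (simp_all del: cleft_in cright_in hdom_ctop hcod_ctop cbot_in hcod_cbot hdom_cbot)
  have vr: "vert r (hdom A g) (hdom A c)" "vert r' (hdom A k) (hdom A l)" "vert r'' (hcod A k) (hcod A l)"
    using r r' r'' by simp_all
  note [simp] = vertD[OF vr(1)] vertD[OF vr(2)] vertD[OF vr(3)]
    cellD[OF \<epsilon>[unfolded globular_def]] cellD[OF \<epsilon>'[unfolded globular_def]] cellD[OF \<epsilon>''[unfolded globular_def]]
  have st: "vert (f\<^sup>\<star>) (hdom A h) (hdom A f)" "vert (h\<^sup>\<star>) (hcod A h) (hdom A h)"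
    "vert (g\<^sup>\<star>) (hdom A k) (hdom A g)" "vert (k\<^sup>\<star>) (hcod A k) (hdom A k)"
    "vert ((h \<cdot> f)\<^sup>\<star>) (hcod A h) (hdom A f)" "vert ((k \<cdot> g)\<^sup>\<star>) (hcod A k) (hdom A g)"
    "vert (f\<^sup>\<star> \<bullet> h\<^sup>\<star>) (hcod A h) (hdom A f)" "vert (g\<^sup>\<star> \<bullet> k\<^sup>\<star>) (hcod A k) (hdom A g)"
    "vert (r \<bullet> g\<^sup>\<star>) (hdom A k) (hdom A c)"
    by (simp_all add: vert_def)
  have c\<epsilon>: "cell A (hone A (hdom A f)) (r \<bullet> x) z (hone A (hdom A c)) \<epsilon>"
    and c\<epsilon>': "cell A (hone A (hdom A h)) (r' \<bullet> x') z' (hone A (hdom A l)) \<epsilon>'"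
    by (simp_all add: cell_def)
  have c\<omega>: "cell A (hone A (hdom A k)) (r \<bullet> g\<^sup>\<star>) r' c (\<beta>\<beta> g \<sslash> \<xi>)"
    and c\<beta>\<gamma>: "cell A (hone A (hdom A h)) (z \<bullet> f\<^sup>\<star>) z' c (\<beta>\<beta> f \<sslash> \<gamma>)"
    by (simp_all add: cell_def)
  note ve = A(3) B(3,4)
  let ?SC = "square_comp (g\<^sup>\<star>) (k\<^sup>\<star>) x'' \<beta> x' x (f\<^sup>\<star>) (h\<^sup>\<star>) \<alpha>"
  have gSC: "globular A (g\<^sup>\<star> \<bullet> k\<^sup>\<star> \<bullet> x'') (x \<bullet> (f\<^sup>\<star> \<bullet> h\<^sup>\<star>)) ?SC"
    by (rule square_comp_globular[OF ve(3,2,1) st(3,4,1,2) B(7) A(7)])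
  have ga: "globular A (g\<^sup>\<star> \<bullet> x') (x \<bullet> f\<^sup>\<star>) \<alpha>" by (rule A(7))
  have s1: "cell A (hone A (hdom A h)) (r \<bullet> g\<^sup>\<star> \<bullet> x') (z \<bullet> f\<^sup>\<star>) (hone A (hdom A c))
      (slide r (g\<^sup>\<star>) x' \<alpha> x (f\<^sup>\<star>) \<epsilon>)"
    by (rule slide_cell[OF ve(2,1) st(3,1) vr(1) ga c\<epsilon>])
  let ?I = "slide r (g\<^sup>\<star>) x' \<alpha> x (f\<^sup>\<star>) \<epsilon>"
  let ?S = "slide r (g\<^sup>\<star> \<bullet> k\<^sup>\<star>) x'' ?SC x (f\<^sup>\<star> \<bullet> h\<^sup>\<star>) \<epsilon>"
  let ?T = "slide (r \<bullet> g\<^sup>\<star>) (k\<^sup>\<star>) x'' \<beta> x' (h\<^sup>\<star>) ?I"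
  let ?a = "asc A r (g\<^sup>\<star>) (k\<^sup>\<star>)" and ?a' = "asc' A r (g\<^sup>\<star>) (k\<^sup>\<star>)" 
  let ?E = "(hunit A (h\<^sup>\<star>) \<sslash> (\<beta>\<beta> f \<sslash> \<gamma>)) \<parallel> (\<beta>\<beta> h \<sslash> \<delta>)"
  have split: "globular A ((k \<cdot> g)\<^sup>\<star>) (g\<^sup>\<star> \<bullet> k\<^sup>\<star>) (split k g)"
    and join: "globular A (f\<^sup>\<star> \<bullet> h\<^sup>\<star>) ((h \<cdot> f)\<^sup>\<star>) (join h f)"
    by (simp_all add: globular_split globular_join)
  note [simp] = cellD[OF split[unfolded globular_def]] cellD[OF join[unfolded globular_def]]
    cellD[OF s1] cellD[OF slide_cell[OF ve(3,1) st(8,7) vr(1) gSC c\<epsilon>]]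
    cellD[OF slide_cell[OF ve(3,2) st(4,2,9) B(7) s1]]
    cellD[OF slide_cell[OF ve(3,2) st(4,2) vr(2) B(7) c\<epsilon>']]
  \<comment> \<open>The comparison cells move to the ends; \<open>join\<close> is absorbed by the transpose of \<open>\<gamma> \<parallel> \<delta>\<close>.\<close>
  have R: "slide r ((k \<cdot> g)\<^sup>\<star>) x'' (coretro_comp f x x' g \<alpha> h x'' k \<beta>) x ((h \<cdot> f)\<^sup>\<star>) \<epsilon>
      \<parallel> (\<beta>\<beta> (h \<cdot> f) \<sslash> (\<gamma> \<parallel> \<delta>))
    = (hunit A x'' \<sslash> (split k g \<sslash> hunit A r)) \<parallel> (?S \<parallel> (asc' A z (f\<^sup>\<star>) (h\<^sup>\<star>) \<parallel> ?E))"
    unfolding coretro_comp_square_comp(1)[OF a b] slide_whisker[OF ve(3,1) st(8,7) vr(1) st(6,5) gSC split join c\<epsilon>]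
    using \<beta>\<beta>_hcomp_vpaste(2)[OF A(1) B(1) m(1) \<gamma> \<delta>] by simp
  have assoc: "(hunit A x'' \<sslash> ?a) \<parallel> ?S = ?T \<parallel> asc A z (f\<^sup>\<star>) (h\<^sup>\<star>)"
    unfolding square_comp_def by (rule slide_assoc[OF ve(3,2,1) vr(1) st(3,4,1,2) B(7) ga c\<epsilon>])
  have inv: "(hunit A x'' \<sslash> ?a') \<parallel> (hunit A x'' \<sslash> ?a) = hunit A (r \<bullet> (g\<^sup>\<star> \<bullet> k\<^sup>\<star>) \<bullet> x'')"
    using hunit_vpaste_hpaste[of ?a' ?a x''] by (simp del: hunit_vpaste_hpaste)
  have S: "?S = (hunit A x'' \<sslash> ?a') \<parallel> (?T \<parallel> asc A z (f\<^sup>\<star>) (h\<^sup>\<star>))"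
    unfolding assoc[symmetric] using hpaste_assoc[of "hunit A x'' \<sslash> ?a'" "hunit A x'' \<sslash> ?a" ?S] inv
    by (simp del: hpaste_assoc)
  have "(hunit A x'' \<sslash> (\<beta>\<beta> (k \<cdot> g) \<sslash> (\<xi> \<parallel> \<theta>))) \<parallel> \<epsilon>''
    = (hunit A x'' \<sslash> (split k g \<sslash> hunit A r)) \<parallel> ((hunit A x'' \<sslash> ?a')
      \<parallel> ((hunit A x'' \<sslash> (hunit A (k\<^sup>\<star>) \<sslash> (\<beta>\<beta> g \<sslash> \<xi>))) \<parallel> ((hunit A x'' \<sslash> (\<beta>\<beta> k \<sslash> \<theta>)) \<parallel> \<epsilon>'')))"
    unfolding \<beta>\<beta>_hcomp_vpaste(1)[OF A(2) B(2) m(2) \<xi> \<theta>] by simp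
  also have "\<dots> = (hunit A x'' \<sslash> (split k g \<sslash> hunit A r)) \<parallel> ((hunit A x'' \<sslash> ?a')
      \<parallel> (((hunit A x'' \<sslash> (hunit A (k\<^sup>\<star>) \<sslash> (\<beta>\<beta> g \<sslash> \<xi>))) \<parallel> slide r' (k\<^sup>\<star>) x'' \<beta> x' (h\<^sup>\<star>) \<epsilon>') \<parallel> (\<beta>\<beta> h \<sslash> \<delta>)))"
    unfolding e\<theta> by simp
  also have "(hunit A x'' \<sslash> (hunit A (k\<^sup>\<star>) \<sslash> (\<beta>\<beta> g \<sslash> \<xi>))) \<parallel> slide r' (k\<^sup>\<star>) x'' \<beta> x' (h\<^sup>\<star>) \<epsilon>'
      = ?T \<parallel> (hunit A (h\<^sup>\<star>) \<sslash> (\<beta>\<beta> f \<sslash> \<gamma>))"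
    unfolding slide_precomp[OF ve(3,2) st(4,2,9) vr(2) B(7) c\<omega> c\<epsilon>'] e\<xi>
    by (rule slide_postcomp[OF ve(3,2) st(4,2,9) B(7) s1 c\<beta>\<gamma>])
  also have "(hunit A x'' \<sslash> (split k g \<sslash> hunit A r)) \<parallel> ((hunit A x'' \<sslash> ?a')
      \<parallel> ((?T \<parallel> (hunit A (h\<^sup>\<star>) \<sslash> (\<beta>\<beta> f \<sslash> \<gamma>))) \<parallel> (\<beta>\<beta> h \<sslash> \<delta>)))
    = (hunit A x'' \<sslash> (split k g \<sslash> hunit A r)) \<parallel> (?S \<parallel> (asc' A z (f\<^sup>\<star>) (h\<^sup>\<star>) \<parallel> ?E))"
    unfolding S by simp
  finally show ?thesis unfolding R .
qed

text \<open>
  Whiskering moves both binding cells of the identity coretrocell out of the slide: one is already the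
  cell on the left-hand side, the other cancels against \<open>\<beta>\<beta>\<close>.
\<close>

lemma hom_action_id:
  assumes x: "vert x a b" and z: "vert z a c" and r: "vert r b c" and \<epsilon>: "globular A (r \<bullet> x) z \<epsilon>"
  shows "(hunit A x \<sslash> (\<beta>\<beta> (hone A b) \<sslash> hunit A r)) \<parallel> \<epsilon>
    = slide r (vid A b) x (coretro_id x) x (vid A a) \<epsilon> \<parallel> (\<beta>\<beta> (hone A a) \<sslash> hunit A z)"
proof -
  note [simp] = vertD[OF x] vertD[OF z] vertD[OF r]
  have c\<epsilon>: "cell A (hone A a) (r \<bullet> x) z (hone A c) \<epsilon>" using \<epsilon> by (simp add: globular_def)
  note [simp] = cellD[OF c\<epsilon>]
  have v: "vert (vid A a) a a" "vert (vid A b) b b" by (simp_all add: vert_def)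
  have g: "globular A (vid A b \<bullet> x) (x \<bullet> vid A a) (hunit A x)" by (simp add: globular_def cell_def)
  have 1: "(\<alpha>\<alpha> (hone A a) \<sslash> hunit A z) \<parallel> (\<beta>\<beta> (hone A a) \<sslash> hunit A z) = hunit A z"
    using interchange[of "\<alpha>\<alpha> (hone A a)" "\<beta>\<beta> (hone A a)" "hunit A z" "hunit A z", symmetric] by simp
  show ?thesis
    unfolding coretrocell_id(2)[OF x]
    by (subst slide_whisker[OF x x v(2,1) r v(2,1) g globular_binding_hone(2)[OF vertD(5)[OF x]]
       globular_binding_hone(1)[OF vertD(4)[OF x]] c\<epsilon>], subst slide_unit[OF x r c\<epsilon>]) (simp add: 1)
qed

end

context right_closed_with_conjoints
begin

lemma right_homD:
  assumes "x \<in> Ver A" "z \<in> Ver A" "vdom A x = vdom A z"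
  shows "vert (rhom z x) (vcod A x) (vcod A z)"
    and "globular A (rhom z x \<bullet> x) z (ev z x)"
    and "\<lbrakk>g \<in> Hor A; hcod A g = vcod A z; vert y (vcod A x) (hdom A g);
        cell A (hone A (vdom A x)) (y \<bullet> x) z g \<alpha>\<rbrakk>
      \<Longrightarrow> \<exists>!\<beta>. cell A (hone A (vcod A x)) y (rhom z x) g \<beta> \<and> (hunit A x \<sslash> \<beta>) \<parallel> ev z x = \<alpha>"
  using right_hom[OF assms] by (simp_all add: is_right_hom_def vert_def)

text \<open>
  The long pasting in the defining equation is a \<open>slide\<close> with the evaluation cell in the place of \<open>\<alpha>\<close>. The
  second part records that it is an admissible input for the universal property of \<open>rhom z' x'\<close>.
\<close>

lemma induced_iff:
  assumes "src m = (x, z)" "tgt m = (x', z')"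
    and x: "x \<in> Ver A" and z: "z \<in> Ver A" and xz: "vdom A x = vdom A z"
    and c: "coretrocell (ar_a m) x x' (ar_b m) (co m)" and g: "cell A (ar_a m) z z' (ar_c m) (ce m)"
  shows "induced m \<xi> \<longleftrightarrow> cell A (ar_b m) (rhom z x) (rhom z' x') (ar_c m) \<xi> \<and>
     (hunit A x' \<sslash> (\<beta>\<beta> (ar_b m) \<sslash> \<xi>)) \<parallel> ev z' x' =
       slide (rhom z x) ((ar_b m)\<^sup>\<star>) x' (co m) x ((ar_a m)\<^sup>\<star>) (ev z x) \<parallel> (\<beta>\<beta> (ar_a m) \<sslash> ce m)"
    and "cell A (hone A (hcod A (ar_a m))) (rhom z x \<bullet> (ar_b m)\<^sup>\<star> \<bullet> x') z' (ar_c m)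
     (slide (rhom z x) ((ar_b m)\<^sup>\<star>) x' (co m) x ((ar_a m)\<^sup>\<star>) (ev z x) \<parallel> (\<beta>\<beta> (ar_a m) \<sslash> ce m))"
proof -
  note C = coretrocellD[OF c]
  note r = right_homD(1,2)[OF x z xz]
  note [simp] = C(1,2) vertD[OF C(3)] vertD[OF C(4)] vertD[OF r(1)] coretrocell_boundary[OF c] cellD[OF g]
    cellD[OF r(2)[unfolded globular_def]]
  have [simp]: "z \<in> Ver A" "vdom A z = hdom A (ar_a m)" using xz z by simp_all
  have [simp]: "ar_c m \<in> Hor A" "vcod A z = hdom A (ar_c m)"
    using cbot_in[of "ce m"] hdom_cbot[of "ce m"] by (simp_all del: cbot_in hdom_cbot)
  have [simp]: "z' \<in> Ver A" "vdom A z' = hcod A (ar_a m)"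
    using cright_in[of "ce m"] hcod_ctop[of "ce m"] by (simp_all del: cright_in hcod_ctop)
  show "induced m \<xi> \<longleftrightarrow> cell A (ar_b m) (rhom z x) (rhom z' x') (ar_c m) \<xi> \<and>
     (hunit A x' \<sslash> (\<beta>\<beta> (ar_b m) \<sslash> \<xi>)) \<parallel> ev z' x' =
       slide (rhom z x) ((ar_b m)\<^sup>\<star>) x' (co m) x ((ar_a m)\<^sup>\<star>) (ev z x) \<parallel> (\<beta>\<beta> (ar_a m) \<sslash> ce m)"
    by (simp add: induced_def slide_def assms(1,2))
  have e: "cell A (hone A (hdom A (ar_a m))) (rhom z x \<bullet> x) z (hone A (hdom A (ar_c m))) (ev z x)"
    by (simp add: cell_def)
  have v: "vert (rhom z x) (hdom A (ar_b m)) (hdom A (ar_c m))" using r(1) by simp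
  note [simp] = cellD[OF slide_cell[OF C(4,3,6,5) v C(7) e]]
  show "cell A (hone A (hcod A (ar_a m))) (rhom z x \<bullet> (ar_b m)\<^sup>\<star> \<bullet> x') z' (ar_c m)
     (slide (rhom z x) ((ar_b m)\<^sup>\<star>) x' (co m) x ((ar_a m)\<^sup>\<star>) (ev z x) \<parallel> (\<beta>\<beta> (ar_a m) \<sslash> ce m))"
    by (simp add: cell_def)
qed

text \<open>
  The universal property of the right hom determines the transpose \<open>\<beta>\<beta> (ar_b m) \<sslash> \<xi>\<close>, and transposition is
  bijective.
\<close>

lemma induced_unique:
  assumes "m \<in> Ar TS"
  shows "\<exists>!\<xi>. induced m \<xi>"
proof -
  obtain x z x' z' where s: "src m = (x, z)" "tgt m = (x', z')"
    and v: "x \<in> Ver A" "z \<in> Ver A" "vdom A x = vdom A z"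
    and v': "x' \<in> Ver A" "z' \<in> Ver A" "vdom A x' = vdom A z'"
    and c: "coretrocell (ar_a m) x x' (ar_b m) (co m)" and g: "cell A (ar_a m) z z' (ar_c m) (ce m)"
    using assms by (rule TS_ArE)
  let ?R = "slide (rhom z x) ((ar_b m)\<^sup>\<star>) x' (co m) x ((ar_a m)\<^sup>\<star>) (ev z x) \<parallel> (\<beta>\<beta> (ar_a m) \<sslash> ce m)"
  note i = induced_iff[OF s v c g]
  note C = coretrocellD[OF c]
  have h: "ar_c m \<in> Hor A" "hdom A (ar_c m) = vcod A z" "hcod A (ar_c m) = vcod A z'"
    using cbot_in[of "ce m"] hdom_cbot[of "ce m"] hcod_cbot[of "ce m"] cellD[OF g] by simp_all
  note r = right_homD(1)[OF v]
  have r': "vert (rhom z x) (hdom A (ar_b m)) (hdom A (ar_c m))"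
    using r vertD[OF C(3)] h by simp
  have y: "vert (rhom z x \<bullet> (ar_b m)\<^sup>\<star>) (vcod A x') (hdom A (ar_c m))"
    using vertD[OF r] vertD[OF C(6)] vertD[OF C(3)] vertD[OF C(4)] h by (simp add: vert_def)
  have k: "cell A (hone A (vdom A x')) (rhom z x \<bullet> (ar_b m)\<^sup>\<star> \<bullet> x') z' (ar_c m) ?R"
    using i(2) vertD[OF C(4)] by simp
  obtain \<zeta> where z: "cell A (hone A (vcod A x')) (rhom z x \<bullet> (ar_b m)\<^sup>\<star>) (rhom z' x') (ar_c m) \<zeta>"
      "(hunit A x' \<sslash> \<zeta>) \<parallel> ev z' x' = ?R"
    and u: "\<And>\<theta>. \<lbrakk>cell A (hone A (vcod A x')) (rhom z x \<bullet> (ar_b m)\<^sup>\<star>) (rhom z' x') (ar_c m) \<theta>;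
      (hunit A x' \<sslash> \<theta>) \<parallel> ev z' x' = ?R\<rbrakk> \<Longrightarrow> \<theta> = \<zeta>"
    using right_homD(3)[OF v' h(1,3) y k] by blast
  have z': "cell A (hone A (hcod A (ar_b m))) (rhom z x \<bullet> (ar_b m)\<^sup>\<star>) (rhom z' x') (ar_c m) \<zeta>"
    using z(1) vertD[OF C(4)] by simp
  note t = conjoint_transpose[OF conjoint[OF C(2)] C(2) r' z']
  have b: "cell A (hone A (vcod A x')) (rhom z x \<bullet> (ar_b m)\<^sup>\<star>) (rhom z' x') (ar_c m) (\<beta>\<beta> (ar_b m) \<sslash> \<xi>)"
    if "cell A (ar_b m) (rhom z x) (rhom z' x') (ar_c m) \<xi>" for \<xi>
    using vpaste_cell[OF _ that] vertD[OF C(4)] C(2) vertD[OF right_homD(1)[OF v']]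
    by (force simp: cell_def)
  have "induced m \<xi> \<longleftrightarrow> cell A (ar_b m) (rhom z x) (rhom z' x') (ar_c m) \<xi> \<and> \<beta>\<beta> (ar_b m) \<sslash> \<xi> = \<zeta>" for \<xi>
    using z u b i(1) by blast
  then show ?thesis unfolding t by simp
qed

lemma rhom_ar_induced: "m \<in> Ar TS \<Longrightarrow> induced m (rhom_ar m)"
  unfolding rhom_ar_def by (rule theI') (rule induced_unique)

lemma rhom_ar_eqI: "\<lbrakk>m \<in> Ar TS; induced m \<xi>\<rbrakk> \<Longrightarrow> rhom_ar m = \<xi>"
  using induced_unique rhom_ar_induced by blast

lemma rhom_functor: "is_functor TS (A1 A) rhom_ob rhom_ar"
proof (rule is_functor.intro[OF TS_category is_functor.axioms(1)[OF vsource]], unfold_locales)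
  fix X assume "X \<in> Ob TS"
  then obtain x z where [simp]: "X = (x, z)" and v: "x \<in> Ver A" "z \<in> Ver A" "vdom A x = vdom A z"
    by (auto simp: TS_simps)
  note r = right_homD(1,2)[OF v]
  show "rhom_ob X \<in> Ob (A1 A)" using vertD[OF r(1)] by (simp add: A1_def rhom_ob_def)
  have I: "Id TS X \<in> Ar TS" using category.Id_in[OF TS_category \<open>X \<in> Ob TS\<close>] .
  have vx: "vert x (vdom A x) (vcod A x)" "vert z (vdom A x) (vcod A z)" using v by (simp_all add: vert_def)
  note i = hom_action_id[OF vx r]
  have "induced (Id TS X) (hunit A (rhom z x))"
    using i coretrocell_id(1)[OF vx(1)] v vertD[OF r(1)]
    by (subst induced_iff(1)[of _ x z x z]) (simp_all add: TS_simps cell_def)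
  then show "rhom_ar (Id TS X) = Id (A1 A) (rhom_ob X)"
    using rhom_ar_eqI[OF I] by (simp add: A1_def rhom_ob_def)
next
  fix m assume m: "m \<in> Ar TS"
  then obtain x z x' z' where s: "src m = (x, z)" "tgt m = (x', z')"
    and v: "x \<in> Ver A" "z \<in> Ver A" "vdom A x = vdom A z"
    and c: "coretrocell (ar_a m) x x' (ar_b m) (co m)" and g: "cell A (ar_a m) z z' (ar_c m) (ce m)"
    by (rule TS_ArE)
  have "cell A (ar_b m) (rhom z x) (rhom z' x') (ar_c m) (rhom_ar m)"
    using induced_iff(1)[OF s v c g] rhom_ar_induced[OF m] by blast
  from cellD[OF this] s
  show "rhom_ar m \<in> Ar (A1 A)" "Dom (A1 A) (rhom_ar m) = rhom_ob (Dom TS m)"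
    "Cod (A1 A) (rhom_ar m) = rhom_ob (Cod TS m)"
    by (simp_all add: A1_def rhom_ob_def TS_simps)
next
  fix m n assume m: "m \<in> Ar TS" and n: "n \<in> Ar TS" and mn: "Cod TS m = Dom TS n"
  obtain x z x' z' where s: "src m = (x, z)" "tgt m = (x', z')"
    and v: "x \<in> Ver A" "z \<in> Ver A" "vdom A x = vdom A z"
    and v': "x' \<in> Ver A" "z' \<in> Ver A" "vdom A x' = vdom A z'"
    and cm: "coretrocell (ar_a m) x x' (ar_b m) (co m)" and gm: "cell A (ar_a m) z z' (ar_c m) (ce m)"
    using m by (rule TS_ArE)
  obtain x'' z'' where s': "src n = (x', z')" "tgt n = (x'', z'')"
    and v'': "x'' \<in> Ver A" "z'' \<in> Ver A" "vdom A x'' = vdom A z''"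
    and cn: "coretrocell (ar_a n) x' x'' (ar_b n) (co n)" and gn: "cell A (ar_a n) z' z'' (ar_c n) (ce n)"
    using n mn s by (elim TS_ArE) (auto simp: TS_simps)
  note r = right_homD(1,2)[OF v] and r' = right_homD(1,2)[OF v'] and r'' = right_homD(1,2)[OF v'']
  have ind_m: "cell A (ar_b m) (rhom z x) (rhom z' x') (ar_c m) (rhom_ar m)"
     "(hunit A x' \<sslash> (\<beta>\<beta> (ar_b m) \<sslash> rhom_ar m)) \<parallel> ev z' x' =
       slide (rhom z x) ((ar_b m)\<^sup>\<star>) x' (co m) x ((ar_a m)\<^sup>\<star>) (ev z x) \<parallel> (\<beta>\<beta> (ar_a m) \<sslash> ce m)"
    using induced_iff(1)[OF s v cm gm] rhom_ar_induced[OF m] by blast+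
  have ind_n: "cell A (ar_b n) (rhom z' x') (rhom z'' x'') (ar_c n) (rhom_ar n)"
     "(hunit A x'' \<sslash> (\<beta>\<beta> (ar_b n) \<sslash> rhom_ar n)) \<parallel> ev z'' x'' =
       slide (rhom z' x') ((ar_b n)\<^sup>\<star>) x'' (co n) x' ((ar_a n)\<^sup>\<star>) (ev z' x') \<parallel> (\<beta>\<beta> (ar_a n) \<sslash> ce n)"
    using induced_iff(1)[OF s' v' cn gn] rhom_ar_induced[OF n] by blast+
  have C: "Comp TS n m \<in> Ar TS" by (rule category.Comp_in[OF TS_category m n mn])
  note eq = hom_action_comp[OF cm cn gm gn r r' r'' ind_m(1) ind_n(1) ind_m(2) ind_n(2)]
  note [simp] = cellD[OF gm] cellD[OF gn] cellD[OF ind_m(1)] cellD[OF ind_n(1)]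
  have "induced (Comp TS n m) (rhom_ar m \<parallel> rhom_ar n)"
    using eq coretro_comp_square_comp(2)[OF cm cn] v s s'
    by (subst induced_iff(1)[of _ x z x'' z'']) (simp_all add: TS_simps cell_def)
  then show "rhom_ar (Comp TS n m) = Comp (A1 A) (rhom_ar n) (rhom_ar m)"
    using rhom_ar_eqI[OF C] by (simp add: A1_def)
qed

end

theorem theorem7p2:
  fixes A :: "('o, 'h, 'v, 'c) dblcat"
    and star :: "'h \<Rightarrow> 'v" and \<alpha>\<alpha> \<beta>\<beta> :: "'h \<Rightarrow> 'c"
    and rhom :: "'v \<Rightarrow> 'v \<Rightarrow> 'v" and ev :: "'v \<Rightarrow> 'v \<Rightarrow> 'c"
  assumes "double_category A"
    and "with_conjoints A star \<alpha>\<alpha> \<beta>\<beta>"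
    and "right_closed A rhom ev"
  shows "(\<forall>m \<in> Ar (with_conjoints.TS A star \<alpha>\<alpha> \<beta>\<beta>).
            \<exists>!\<xi>. right_closed_with_conjoints.induced A star \<beta>\<beta> rhom ev m \<xi>) \<and>
         is_functor (with_conjoints.TS A star \<alpha>\<alpha> \<beta>\<beta>) (A1 A)
           (right_closed_with_conjoints.rhom_ob rhom)
           (right_closed_with_conjoints.rhom_ar A star \<beta>\<beta> rhom ev)"
proof -
  interpret right_closed_with_conjoints A star \<alpha>\<alpha> \<beta>\<beta> rhom ev
    using assms(2,3) by (rule right_closed_with_conjoints.intro)
  show ?thesis using induced_unique rhom_functor by blast
qed

end
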